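(* For every formula $\phi$, $\phi$ is a theorem of $\mathsf{MS^2IC}_u$ if and only if $\phi$ is valid in every upper continuous modal compingent algebra.
   Context: Language: propositional variables, $\top,\bot$, $\neg,\wedge,\vee,\to,\leftrightarrow$, a binary connective $\rightsquigarrow$ and a unary modality $\Box$; $\Diamond\phi:=\neg\Box\neg\phi$, $[\forall]\phi:=\top\rightsquigarrow\phi$. $\mathsf{MS^2IC}_u$: theorems are the least set containing all instances of classical tautologies and of (A1) $(\bot\rightsquigarrow\phi)\wedge(\phi\rightsquigarrow\top)$; (A2) $((\phi\vee\psi)\rightsquigarrow\chi)\leftrightarrow((\phi\rightsquigarrow\chi)\wedge(\psi\rightsquigarrow\chi))$; (A3) $(\phi\rightsquigarrow(\psi\wedge\chi))\leftrightarrow((\phi\rightsquigarrow\psi)\wedge(\phi\rightsquigarrow\chi))$; (A4) $(\phi\rightsquigarrow\psi)\to(\phi\to\psi)$; (A5) $(\phi\rightsquigarrow\psi)\leftrightarrow(\neg\psi\rightsquigarrow\neg\phi)$; (A8) $[\forall]\phi\to[\forall][\forall]\phi$; (A9) $\neg[\forall]\phi\to[\forall]\neg[\forall]\phi$; (A10) $(\phi\rightsquigarrow\psi)\leftrightarrow[\forall](\phi\rightsquigarrow\psi)$; (A11) $[\forall]\phi\to(\neg[\forall]\phi\rightsquigarrow\bot)$; (K) $\Box(\phi\to\psi)\to(\Box\phi\to\Box\psi)$; (Add) $(\phi\rightsquigarrow\psi)\to(\Box\phi\rightsquigarrow\Box\psi)$; closed under modus ponens, from $\phi$ infer $[\forall]\phi$,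 from $\phi$ infer $\Box\phi$, and the rules (with $p$ a variable not occurring in $\phi,\psi,\chi$): from $(\phi\rightsquigarrow p)\wedge(p\rightsquigarrow\psi)\to\chi$ infer $(\phi\rightsquigarrow\psi)\to\chi$; from $(p\rightsquigarrow\phi)\wedge p\to\chi$ infer $\phi\to\chi$; from $(p\rightsquigarrow\phi)\wedge\Box p\to\psi$ infer $\Box\phi\to\psi$. A contact algebra is $(B,\prec)$ with $B$ Boolean and $\prec$ satisfying: $0\prec0$, $1\prec1$; $a\prec b,a\prec c\Rightarrow a\prec b\wedge c$; $a\prec c,b\prec c\Rightarrow a\vee b\prec c$; $a\le b\prec c\le d\Rightarrow a\prec d$; $a\prec b\Rightarrow a\le b$; $a\prec b\Rightarrow\neg b\prec\neg a$; compingent if also $a\prec b$ implies $a\prec c\prec b$ for some $c$ and $a\neq0$ implies $b\prec a$ for some $b\ne0$. An upper continuous modal compingent algebra is $(B,\prec,\Diamond)$ with $(B,\prec)$ compingent, $\Diamond$ de Vries additive ($\Diamond0=0$, and $a_1\prec b_1,a_2\prec b_2$ imply $\Diamond(a_1\vee a_2)\prec\Diamond b_1\vee\Diamond b_2$) and upper continuous (for each $a$ the meet of $\{\Diamond b:a\prec b\}$ exists and equals $\Diamond a$). A valuation $v$ maps variables into $B$, extends with Boolean operations, $v(\phi\rightsquigarrow\psi)=1$ if $v(\phi)\prec v(\psi)$ else $0$, $v(\Box\phi)=\neg\Diamond\neg v(\phi)$; valid means $v(\phi)=1$ for all $v$.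
   Formalization: The calculus is given one extra rule, from φ↔ψ infer (φ⇝χ)↔(ψ⇝χ), since without it completeness fails: (p⇝q)→((p∧p)⇝q) is valid in every such algebra but not derivable from the listed axioms and rules. *)

theory Defs
  imports Main
begin

datatype (vars: 'v) fm =
    Var 'v
  | Top (\<open>\<^bold>\<top>\<close>)
  | Bot (\<open>\<^bold>\<bottom>\<close>)
  | Neg "'v fm" (\<open>\<^bold>\<not> _\<close> [80] 80)
  | And "'v fm" "'v fm" (infixr \<open>\<^bold>\<and>\<close> 75)
  | Or "'v fm" "'v fm" (infixr \<open>\<^bold>\<or>\<close> 70)
  | Imp "'v fm" "'v fm" (infixr \<open>\<^bold>\<rightarrow>\<close> 60)
  | Iff "'v fm" "'v fm" (infixr \<open>\<^bold>\<leftrightarrow>\<close> 55)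
  | SImp "'v fm" "'v fm" (infix \<open>\<^bold>\<leadsto>\<close> 65)
  | Box "'v fm" (\<open>\<^bold>\<box> _\<close> [80] 80)

abbreviation AllBox :: "'v fm \<Rightarrow> 'v fm" (\<open>\<^bold>[\<^bold>\<forall>\<^bold>] _\<close> [80] 80)
  where "\<^bold>[\<^bold>\<forall>\<^bold>] \<phi> \<equiv> \<^bold>\<top> \<^bold>\<leadsto> \<phi>"

text \<open>Instances of classical tautologies: variables, strict implications and boxed
  formulas are the atoms, and \<open>w\<close> assigns them arbitrary truth values.\<close>

primrec prop_eval :: "('v fm \<Rightarrow> bool) \<Rightarrow> 'v fm \<Rightarrow> bool" where
  "prop_eval w (Var p) \<longleftrightarrow> w (Var p)"
| "prop_eval w \<^bold>\<top> \<longleftrightarrow> True"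
| "prop_eval w \<^bold>\<bottom> \<longleftrightarrow> False"
| "prop_eval w (\<^bold>\<not> \<phi>) \<longleftrightarrow> \<not> prop_eval w \<phi>"
| "prop_eval w (\<phi> \<^bold>\<and> \<psi>) \<longleftrightarrow> prop_eval w \<phi> \<and> prop_eval w \<psi>"
| "prop_eval w (\<phi> \<^bold>\<or> \<psi>) \<longleftrightarrow> prop_eval w \<phi> \<or> prop_eval w \<psi>"
| "prop_eval w (\<phi> \<^bold>\<rightarrow> \<psi>) \<longleftrightarrow> (prop_eval w \<phi> \<longrightarrow> prop_eval w \<psi>)"
| "prop_eval w (\<phi> \<^bold>\<leftrightarrow> \<psi>) \<longleftrightarrow> (prop_eval w \<phi> \<longleftrightarrow> prop_eval w \<psi>)"
| "prop_eval w (\<phi> \<^bold>\<leadsto> \<psi>) \<longleftrightarrow> w (\<phi> \<^bold>\<leadsto> \<psi>)"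
| "prop_eval w (\<^bold>\<box> \<phi>) \<longleftrightarrow> w (\<^bold>\<box> \<phi>)"

definition tautology_instance :: "'v fm \<Rightarrow> bool" where
  "tautology_instance \<phi> \<longleftrightarrow> (\<forall>w. prop_eval w \<phi>)"

text \<open>The rule \<open>Congr\<close> makes explicit that \<open>\<leadsto>\<close> respects provable equivalence. Presentations of the
  calculus leave it tacit, but it does not follow from the other axioms and rules. Countermodel:
  let \<open>comp \<phi>\<close> be the set of formulas obtained by splitting \<open>\<phi>\<close> along \<open>\<or>\<close>, \<open>\<not>\<not>\<close> and \<open>\<not>(_ \<and> _)\<close>
  (none for \<open>\<bottom>\<close> and \<open>\<not>\<top>\<close>); evaluate two-valued, with \<open>\<box>\<phi>\<close> as \<open>\<phi>\<close>, and \<open>\<phi> \<leadsto> \<psi>\<close> true iff \<open>\<phi> \<rightarrow> \<psi>\<close>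
  is true and no pair in \<open>comp \<phi> \<times> comp (\<not>\<psi>)\<close> consists of a conjunction and a negated variable
  (in either order). Every other clause below preserves truth under all substitutions, yet
  \<open>(p \<leadsto> q) \<rightarrow> ((p \<and> p) \<leadsto> q)\<close>, which is valid in every contact algebra, fails when \<open>p\<close> and \<open>q\<close>
  are distinct false variables. Congruence in the second argument follows by \<open>A5\<close>, and that of
  \<open>\<box>\<close> by \<open>K\<close> and \<open>Nec_Box\<close>.\<close>

inductive MS2IC_u :: "nat fm \<Rightarrow> bool" where
  Taut: "tautology_instance \<phi> \<Longrightarrow> MS2IC_u \<phi>"
| A1: "MS2IC_u ((\<^bold>\<bottom> \<^bold>\<leadsto> \<phi>) \<^bold>\<and> (\<phi> \<^bold>\<leadsto> \<^bold>\<top>))"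
| A2: "MS2IC_u (((\<phi> \<^bold>\<or> \<psi>) \<^bold>\<leadsto> \<chi>) \<^bold>\<leftrightarrow> ((\<phi> \<^bold>\<leadsto> \<chi>) \<^bold>\<and> (\<psi> \<^bold>\<leadsto> \<chi>)))"
| A3: "MS2IC_u ((\<phi> \<^bold>\<leadsto> (\<psi> \<^bold>\<and> \<chi>)) \<^bold>\<leftrightarrow> ((\<phi> \<^bold>\<leadsto> \<psi>) \<^bold>\<and> (\<phi> \<^bold>\<leadsto> \<chi>)))"
| A4: "MS2IC_u ((\<phi> \<^bold>\<leadsto> \<psi>) \<^bold>\<rightarrow> (\<phi> \<^bold>\<rightarrow> \<psi>))"
| A5: "MS2IC_u ((\<phi> \<^bold>\<leadsto> \<psi>) \<^bold>\<leftrightarrow> (\<^bold>\<not> \<psi> \<^bold>\<leadsto> \<^bold>\<not> \<phi>))"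
| A8: "MS2IC_u (\<^bold>[\<^bold>\<forall>\<^bold>] \<phi> \<^bold>\<rightarrow> \<^bold>[\<^bold>\<forall>\<^bold>] (\<^bold>[\<^bold>\<forall>\<^bold>] \<phi>))"
| A9: "MS2IC_u (\<^bold>\<not> (\<^bold>[\<^bold>\<forall>\<^bold>] \<phi>) \<^bold>\<rightarrow> \<^bold>[\<^bold>\<forall>\<^bold>] (\<^bold>\<not> (\<^bold>[\<^bold>\<forall>\<^bold>] \<phi>)))"
| A10: "MS2IC_u ((\<phi> \<^bold>\<leadsto> \<psi>) \<^bold>\<leftrightarrow> \<^bold>[\<^bold>\<forall>\<^bold>] (\<phi> \<^bold>\<leadsto> \<psi>))"
| A11: "MS2IC_u (\<^bold>[\<^bold>\<forall>\<^bold>] \<phi> \<^bold>\<rightarrow> (\<^bold>\<not> (\<^bold>[\<^bold>\<forall>\<^bold>] \<phi>) \<^bold>\<leadsto> \<^bold>\<bottom>))"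
| K: "MS2IC_u (\<^bold>\<box> (\<phi> \<^bold>\<rightarrow> \<psi>) \<^bold>\<rightarrow> (\<^bold>\<box> \<phi> \<^bold>\<rightarrow> \<^bold>\<box> \<psi>))"
| Add: "MS2IC_u ((\<phi> \<^bold>\<leadsto> \<psi>) \<^bold>\<rightarrow> (\<^bold>\<box> \<phi> \<^bold>\<leadsto> \<^bold>\<box> \<psi>))"
| MP: "MS2IC_u (\<phi> \<^bold>\<rightarrow> \<psi>) \<Longrightarrow> MS2IC_u \<phi> \<Longrightarrow> MS2IC_u \<psi>"
| Nec_All: "MS2IC_u \<phi> \<Longrightarrow> MS2IC_u (\<^bold>[\<^bold>\<forall>\<^bold>] \<phi>)"
| Nec_Box: "MS2IC_u \<phi> \<Longrightarrow> MS2IC_u (\<^bold>\<box> \<phi>)"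
| Congr: "MS2IC_u (\<phi> \<^bold>\<leftrightarrow> \<psi>) \<Longrightarrow> MS2IC_u ((\<phi> \<^bold>\<leadsto> \<chi>) \<^bold>\<leftrightarrow> (\<psi> \<^bold>\<leadsto> \<chi>))"
| Rule_density: "MS2IC_u ((\<phi> \<^bold>\<leadsto> Var p) \<^bold>\<and> (Var p \<^bold>\<leadsto> \<psi>) \<^bold>\<rightarrow> \<chi>)
    \<Longrightarrow> p \<notin> vars \<phi> \<union> vars \<psi> \<union> vars \<chi> \<Longrightarrow> MS2IC_u ((\<phi> \<^bold>\<leadsto> \<psi>) \<^bold>\<rightarrow> \<chi>)"
| Rule_join: "MS2IC_u ((Var p \<^bold>\<leadsto> \<phi>) \<^bold>\<and> Var p \<^bold>\<rightarrow> \<chi>)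
    \<Longrightarrow> p \<notin> vars \<phi> \<union> vars \<chi> \<Longrightarrow> MS2IC_u (\<phi> \<^bold>\<rightarrow> \<chi>)"
| Rule_upper: "MS2IC_u ((Var p \<^bold>\<leadsto> \<phi>) \<^bold>\<and> \<^bold>\<box> (Var p) \<^bold>\<rightarrow> \<psi>)
    \<Longrightarrow> p \<notin> vars \<phi> \<union> vars \<psi> \<Longrightarrow> MS2IC_u (\<^bold>\<box> \<phi> \<^bold>\<rightarrow> \<psi>)"

text \<open>Algebras live on a carrier set inside a type \<open>'a\<close>, so that quantifying over the algebras on
  an arbitrary infinite \<open>'a\<close> covers algebras of every cardinality. On a
  finite \<open>'a\<close> there are only algebras of bounded size. The one-element algebra is admitted.\<close>

record 'a bool_alg =
  carrier :: "'a set"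
  meet :: "'a \<Rightarrow> 'a \<Rightarrow> 'a" (infixl \<open>\<sqinter>\<index>\<close> 70)
  join :: "'a \<Rightarrow> 'a \<Rightarrow> 'a" (infixl \<open>\<squnion>\<index>\<close> 65)
  cmpl :: "'a \<Rightarrow> 'a" (\<open>\<sim>\<index> _\<close> [81] 80)
  bzero :: 'a (\<open>\<zero>\<index>\<close>)
  bone :: 'a (\<open>\<one>\<index>\<close>)

definition ble :: "('a, 'm) bool_alg_scheme \<Rightarrow> 'a \<Rightarrow> 'a \<Rightarrow> bool" (infix \<open>\<sqsubseteq>\<index>\<close> 50)
  where "a \<sqsubseteq>\<^bsub>A\<^esub> b \<longleftrightarrow> a \<sqinter>\<^bsub>A\<^esub> b = a"

record 'a contact_alg = "'a bool_alg" +
  prec :: "'a \<Rightarrow> 'a \<Rightarrow> bool" (infix \<open>\<prec>\<index>\<close> 50)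

record 'a modal_alg = "'a contact_alg" +
  dia :: "'a \<Rightarrow> 'a" (\<open>\<diamond>\<index> _\<close> [81] 80)

locale boolean_alg =
  fixes A :: "('a, 'm) bool_alg_scheme" (structure)
  assumes meet_closed: "\<lbrakk>a \<in> carrier A; b \<in> carrier A\<rbrakk> \<Longrightarrow> a \<sqinter> b \<in> carrier A"
    and join_closed: "\<lbrakk>a \<in> carrier A; b \<in> carrier A\<rbrakk> \<Longrightarrow> a \<squnion> b \<in> carrier A"
    and cmpl_closed: "a \<in> carrier A \<Longrightarrow> \<sim> a \<in> carrier A"
    and zero_closed: "\<zero> \<in> carrier A"
    and one_closed: "\<one> \<in> carrier A"
    and meet_assoc: "\<lbrakk>a \<in> carrier A; b \<in> carrier A; c \<in> carrier A\<rbrakk>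
      \<Longrightarrow> (a \<sqinter> b) \<sqinter> c = a \<sqinter> (b \<sqinter> c)"
    and join_assoc: "\<lbrakk>a \<in> carrier A; b \<in> carrier A; c \<in> carrier A\<rbrakk>
      \<Longrightarrow> (a \<squnion> b) \<squnion> c = a \<squnion> (b \<squnion> c)"
    and meet_comm: "\<lbrakk>a \<in> carrier A; b \<in> carrier A\<rbrakk> \<Longrightarrow> a \<sqinter> b = b \<sqinter> a"
    and join_comm: "\<lbrakk>a \<in> carrier A; b \<in> carrier A\<rbrakk> \<Longrightarrow> a \<squnion> b = b \<squnion> a"
    and meet_join_distrib: "\<lbrakk>a \<in> carrier A; b \<in> carrier A; c \<in> carrier A\<rbrakk>
      \<Longrightarrow> a \<sqinter> (b \<squnion> c) = (a \<sqinter> b) \<squnion> (a \<sqinter> c)"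
    and join_meet_distrib: "\<lbrakk>a \<in> carrier A; b \<in> carrier A; c \<in> carrier A\<rbrakk>
      \<Longrightarrow> a \<squnion> (b \<sqinter> c) = (a \<squnion> b) \<sqinter> (a \<squnion> c)"
    and meet_one: "a \<in> carrier A \<Longrightarrow> a \<sqinter> \<one> = a"
    and join_zero: "a \<in> carrier A \<Longrightarrow> a \<squnion> \<zero> = a"
    and meet_cmpl: "a \<in> carrier A \<Longrightarrow> a \<sqinter> \<sim> a = \<zero>"
    and join_cmpl: "a \<in> carrier A \<Longrightarrow> a \<squnion> \<sim> a = \<one>"

locale contact_algebra = boolean_alg A
  for A :: "('a, 'm) contact_alg_scheme" (structure) +
  assumes prec_zero: "\<zero> \<prec> \<zero>"
    and prec_one: "\<one> \<prec> \<one>"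
    and prec_meet: "\<lbrakk>a \<in> carrier A; b \<in> carrier A; c \<in> carrier A; a \<prec> b; a \<prec> c\<rbrakk>
      \<Longrightarrow> a \<prec> b \<sqinter> c"
    and prec_join: "\<lbrakk>a \<in> carrier A; b \<in> carrier A; c \<in> carrier A; a \<prec> c; b \<prec> c\<rbrakk>
      \<Longrightarrow> a \<squnion> b \<prec> c"
    and prec_mono: "\<lbrakk>a \<in> carrier A; b \<in> carrier A; c \<in> carrier A; d \<in> carrier A;
      a \<sqsubseteq> b; b \<prec> c; c \<sqsubseteq> d\<rbrakk> \<Longrightarrow> a \<prec> d"
    and prec_le: "\<lbrakk>a \<in> carrier A; b \<in> carrier A; a \<prec> b\<rbrakk> \<Longrightarrow> a \<sqsubseteq> b"
    and prec_cmpl: "\<lbrakk>a \<in> carrier A; b \<in> carrier A; a \<prec> b\<rbrakk> \<Longrightarrow> \<sim> b \<prec> \<sim> a"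

locale compingent_algebra = contact_algebra +
  assumes prec_dense: "\<lbrakk>a \<in> carrier A; b \<in> carrier A; a \<prec> b\<rbrakk>
      \<Longrightarrow> \<exists>c\<in>carrier A. a \<prec> c \<and> c \<prec> b"
    and prec_below: "\<lbrakk>a \<in> carrier A; a \<noteq> \<zero>\<rbrakk>
      \<Longrightarrow> \<exists>b\<in>carrier A. b \<noteq> \<zero> \<and> b \<prec> a"

definition is_meet_of :: "('a, 'm) bool_alg_scheme \<Rightarrow> 'a \<Rightarrow> 'a set \<Rightarrow> bool" where
  "is_meet_of A m S \<longleftrightarrow> m \<in> carrier A \<and> (\<forall>s\<in>S. m \<sqsubseteq>\<^bsub>A\<^esub> s) \<and>
     (\<forall>l\<in>carrier A. (\<forall>s\<in>S. l \<sqsubseteq>\<^bsub>A\<^esub> s) \<longrightarrow> l \<sqsubseteq>\<^bsub>A\<^esub> m)"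

locale upper_continuous_modal_compingent_algebra = compingent_algebra A
  for A :: "('a, 'm) modal_alg_scheme" (structure) +
  assumes dia_closed: "a \<in> carrier A \<Longrightarrow> \<diamond> a \<in> carrier A"
    and dia_zero: "\<diamond> \<zero> = \<zero>"
    and dia_additive: "\<lbrakk>a1 \<in> carrier A; b1 \<in> carrier A; a2 \<in> carrier A; b2 \<in> carrier A;
      a1 \<prec> b1; a2 \<prec> b2\<rbrakk> \<Longrightarrow> \<diamond> (a1 \<squnion> a2) \<prec> \<diamond> b1 \<squnion> \<diamond> b2"
    and dia_upper_continuous: "a \<in> carrier A
      \<Longrightarrow> is_meet_of A (\<diamond> a) {\<diamond> b | b. b \<in> carrier A \<and> a \<prec> b}"

primrec eval :: "('a, 'm) modal_alg_scheme \<Rightarrow> ('v \<Rightarrow> 'a) \<Rightarrow> 'v fm \<Rightarrow> 'a" where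
  "eval A v (Var p) = v p"
| "eval A v \<^bold>\<top> = \<one>\<^bsub>A\<^esub>"
| "eval A v \<^bold>\<bottom> = \<zero>\<^bsub>A\<^esub>"
| "eval A v (\<^bold>\<not> \<phi>) = \<sim>\<^bsub>A\<^esub> eval A v \<phi>"
| "eval A v (\<phi> \<^bold>\<and> \<psi>) = eval A v \<phi> \<sqinter>\<^bsub>A\<^esub> eval A v \<psi>"
| "eval A v (\<phi> \<^bold>\<or> \<psi>) = eval A v \<phi> \<squnion>\<^bsub>A\<^esub> eval A v \<psi>"
| "eval A v (\<phi> \<^bold>\<rightarrow> \<psi>) = (\<sim>\<^bsub>A\<^esub> eval A v \<phi>) \<squnion>\<^bsub>A\<^esub> eval A v \<psi>"
| "eval A v (\<phi> \<^bold>\<leftrightarrow> \<psi>) = ((\<sim>\<^bsub>A\<^esub> eval A v \<phi>) \<squnion>\<^bsub>A\<^esub> eval A v \<psi>)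
     \<sqinter>\<^bsub>A\<^esub> ((\<sim>\<^bsub>A\<^esub> eval A v \<psi>) \<squnion>\<^bsub>A\<^esub> eval A v \<phi>)"
| "eval A v (\<phi> \<^bold>\<leadsto> \<psi>) = (if eval A v \<phi> \<prec>\<^bsub>A\<^esub> eval A v \<psi> then \<one>\<^bsub>A\<^esub> else \<zero>\<^bsub>A\<^esub>)"
| "eval A v (\<^bold>\<box> \<phi>) = \<sim>\<^bsub>A\<^esub> (\<diamond>\<^bsub>A\<^esub> (\<sim>\<^bsub>A\<^esub> eval A v \<phi>))"

definition valid_in :: "('a, 'm) modal_alg_scheme \<Rightarrow> 'v fm \<Rightarrow> bool" where
  "valid_in A \<phi> \<longleftrightarrow> (\<forall>v. range v \<subseteq> carrier A \<longrightarrow> eval A v \<phi> = \<one>\<^bsub>A\<^esub>)"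

end

theory Submission
  imports Defs "HOL-Library.Countable"
begin

text \<open>Soundness reduces every Boolean computation to membership in ultrafilters; \<open>K\<close> holds because
  upper continuity turns de Vries additivity into additivity of \<open>\<diamond>\<close>, and the three variable rules
  express density of \<open>\<prec>\<close>, that each element is the join of the elements well below it, and upper
  continuity.

  For completeness, an unprovable \<open>\<phi>\<close> gives a maximal consistent set \<open>\<Gamma>\<close> containing \<open>\<not>\<phi>\<close>, built as the
  limit of a chain of single formulas, so that fresh variables are available as witnesses at each
  stage. The rules for the last two kinds of witness first have to be moved below \<open>\<not>[\<forall>]\<not>\<close>, which
  works because \<open>[\<forall>]\<close> is an S5 modality. Formulas modulo \<open>[\<forall>](\<phi> \<leftrightarrow> \<psi>) \<in> \<Gamma>\<close>, with \<open>\<prec>\<close> read off from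
  membership of \<open>\<phi> \<leadsto> \<psi>\<close> in \<open>\<Gamma>\<close>, form a countable algebra, which is copied into the infinite type.\<close>

section \<open>Soundness\<close>

context boolean_alg
begin

lemma meet_idem:
  assumes "a \<in> carrier A"
  shows "a \<sqinter> a = a"
proof -
  have "a \<sqinter> a = (a \<sqinter> a) \<squnion> (a \<sqinter> \<sim> a)"
    using assms by (simp add: meet_cmpl join_zero meet_closed)
  also have "\<dots> = a \<sqinter> (a \<squnion> \<sim> a)"
    using assms by (simp only: meet_join_distrib cmpl_closed)
  finally show ?thesis using assms by (simp add: join_cmpl meet_one)
qed

lemma join_idem:
  assumes "a \<in> carrier A"
  shows "a \<squnion> a = a"
proof -
  have "a \<squnion> a = (a \<squnion> a) \<sqinter> (a \<squnion> \<sim> a)"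
    using assms by (simp add: join_cmpl meet_one join_closed)
  also have "\<dots> = a \<squnion> (a \<sqinter> \<sim> a)"
    using assms by (simp only: join_meet_distrib cmpl_closed)
  finally show ?thesis using assms by (simp add: meet_cmpl join_zero)
qed

lemma meet_zero:
  assumes "a \<in> carrier A"
  shows "a \<sqinter> \<zero> = \<zero>"
proof -
  have "a \<sqinter> \<zero> = (a \<sqinter> a) \<sqinter> \<sim> a"
    using assms by (simp only: meet_assoc meet_cmpl cmpl_closed)
  then show ?thesis using assms by (simp add: meet_idem meet_cmpl)
qed

lemma join_one:
  assumes "a \<in> carrier A"
  shows "a \<squnion> \<one> = \<one>"
proof -
  have "a \<squnion> \<one> = (a \<squnion> a) \<squnion> \<sim> a"
    using assms by (simp only: join_assoc join_cmpl cmpl_closed)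
  then show ?thesis using assms by (simp add: join_idem join_cmpl)
qed

lemma one_meet: "a \<in> carrier A \<Longrightarrow> \<one> \<sqinter> a = a"
  using meet_comm[of a \<one>] by (simp add: meet_one one_closed)

lemma meet_join_absorb:
  assumes "a \<in> carrier A" "b \<in> carrier A"
  shows "a \<sqinter> (a \<squnion> b) = a"
proof -
  have "a \<sqinter> (a \<squnion> b) = (a \<sqinter> \<one>) \<squnion> (a \<sqinter> b)"
    using assms by (simp add: meet_join_distrib meet_idem meet_one)
  also have "\<dots> = a \<sqinter> (b \<squnion> \<one>)"
    using assms by (simp add: meet_join_distrib one_closed join_comm meet_closed)
  finally show ?thesis
    using assms by (simp add: join_one meet_one)
qed

lemma meet_split:
  assumes "a \<in> carrier A" "b \<in> carrier A"
  shows "(a \<sqinter> b) \<squnion> (a \<sqinter> \<sim> b) = a"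
proof -
  have "(a \<sqinter> b) \<squnion> (a \<sqinter> \<sim> b) = a \<sqinter> (b \<squnion> \<sim> b)"
    using assms by (simp only: meet_join_distrib cmpl_closed)
  then show ?thesis using assms by (simp add: join_cmpl meet_one)
qed

lemma meet_eq_zero_imp_le_cmpl:
  assumes "a \<in> carrier A" "b \<in> carrier A" "a \<sqinter> b = \<zero>"
  shows "a \<sqinter> \<sim> b = a"
  using meet_split[OF assms(1,2)] assms
  by (simp add: join_comm[OF zero_closed] join_zero meet_closed cmpl_closed)

text \<open>The empty set qualifies, so nonemptiness is a separate assumption where a filter is
  extended.\<close>

definition proper_filter :: "'a set \<Rightarrow> bool" where
  "proper_filter F \<longleftrightarrow> F \<subseteq> carrier A \<and> \<zero> \<notin> F \<and> (\<forall>x\<in>F. \<forall>y\<in>F. x \<sqinter> y \<in> F) \<and>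
     (\<forall>x\<in>F. \<forall>y\<in>carrier A. x \<sqinter> y = x \<longrightarrow> y \<in> F)"

text \<open>Encoded as a homomorphism onto truth values rather than as a maximal filter, so that
  membership of a compound term in \<open>U\<close> rewrites to propositional logic.\<close>

definition ultrafilter :: "'a set \<Rightarrow> bool" where
  "ultrafilter U \<longleftrightarrow> \<one> \<in> U \<and> \<zero> \<notin> U \<and> (\<forall>x\<in>carrier A. \<sim> x \<in> U \<longleftrightarrow> x \<notin> U) \<and>
     (\<forall>x\<in>carrier A. \<forall>y\<in>carrier A. x \<sqinter> y \<in> U \<longleftrightarrow> x \<in> U \<and> y \<in> U) \<and>
     (\<forall>x\<in>carrier A. \<forall>y\<in>carrier A. x \<squnion> y \<in> U \<longleftrightarrow> x \<in> U \<or> y \<in> U)"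

text \<open>The filter generated by \<open>F\<close> and \<open>c\<close> consists of the elements
  above some \<open>m \<sqinter> c\<close> with \<open>m \<in> F\<close>. It omits \<zero>, because
  \<open>m \<sqinter> c = \<zero>\<close> would put \<open>m\<close> below \<open>\<sim> c\<close>
  and thus \<open>\<sim> c\<close> into \<open>F\<close>.\<close>

lemma proper_filter_extend:
  assumes F: "proper_filter F" and "F \<noteq> {}" and c: "c \<in> carrier A" and nc: "\<sim> c \<notin> F"
  shows "\<exists>G. proper_filter G \<and> F \<subseteq> G \<and> c \<in> G"
proof (intro exI conjI)
  let ?G = "{x \<in> carrier A. \<exists>m\<in>F. (m \<sqinter> c) \<sqinter> x = m \<sqinter> c}"
  have FA: "x \<in> carrier A" if "x \<in> F" for x
    using F that by (auto simp: proper_filter_def)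
  have swap: "(m \<sqinter> c) \<sqinter> x = (m \<sqinter> x) \<sqinter> c" if "m \<in> carrier A" "x \<in> carrier A" for m x
    by (metis c meet_assoc meet_comm that)
  show "F \<subseteq> ?G"
  proof
    fix x assume x: "x \<in> F"
    then have "(x \<sqinter> c) \<sqinter> x = x \<sqinter> c"
      using FA swap by (simp add: meet_idem)
    then show "x \<in> ?G" using x FA by blast
  qed
  obtain m0 where "m0 \<in> F" using \<open>F \<noteq> {}\<close> by blast
  moreover have "(m0 \<sqinter> c) \<sqinter> c = m0 \<sqinter> c"
    using FA[OF \<open>m0 \<in> F\<close>] c by (simp add: meet_assoc meet_idem)
  ultimately show "c \<in> ?G" using c by blast
  show "proper_filter ?G"
    unfolding proper_filter_def
  proof (intro conjI ballI impI)
    show "\<zero> \<notin> ?G"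
    proof
      assume "\<zero> \<in> ?G"
      then obtain m where m: "m \<in> F" "(m \<sqinter> c) \<sqinter> \<zero> = m \<sqinter> c" by blast
      then have "m \<sqinter> c = \<zero>" using FA c by (simp add: meet_zero meet_closed)
      then have "m \<sqinter> \<sim> c = m" using FA m c by (simp add: meet_eq_zero_imp_le_cmpl)
      then show False
        using F m(1) c nc cmpl_closed unfolding proper_filter_def by blast
    qed
  next
    fix x y assume "x \<in> ?G" "y \<in> ?G"
    then obtain m n where mn: "m \<in> F" "n \<in> F" "(m \<sqinter> c) \<sqinter> x = m \<sqinter> c" "(n \<sqinter> c) \<sqinter> y = n \<sqinter> c"
      and xy: "x \<in> carrier A" "y \<in> carrier A" by blast
    have mc: "m \<sqinter> c \<in> carrier A" "n \<sqinter> c \<in> carrier A" "m \<in> carrier A" "n \<in> carrier A"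
      using FA mn c meet_closed by auto
    have eq: "(m \<sqinter> n) \<sqinter> c = (m \<sqinter> c) \<sqinter> (n \<sqinter> c)"
      using c mc by (metis meet_assoc meet_comm meet_idem)
    have "((m \<sqinter> c) \<sqinter> (n \<sqinter> c)) \<sqinter> (x \<sqinter> y) = ((m \<sqinter> c) \<sqinter> x) \<sqinter> ((n \<sqinter> c) \<sqinter> y)"
      using mc xy by (smt (verit) meet_assoc meet_comm meet_closed)
    then have "((m \<sqinter> n) \<sqinter> c) \<sqinter> (x \<sqinter> y) = (m \<sqinter> n) \<sqinter> c"
      using mn eq by simp
    moreover have "m \<sqinter> n \<in> F" using F mn unfolding proper_filter_def by blast
    ultimately show "x \<sqinter> y \<in> ?G" using xy meet_closed by blast
  next
    fix x y assume "x \<in> ?G" and y: "y \<in> carrier A" "x \<sqinter> y = x"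
    then obtain m where m: "m \<in> F" "(m \<sqinter> c) \<sqinter> x = m \<sqinter> c" "x \<in> carrier A" by blast
    have "(m \<sqinter> c) \<sqinter> y = m \<sqinter> c"
      using m y FA c by (metis meet_assoc meet_closed)
    then show "y \<in> ?G" using m y by blast
  qed auto
qed

text \<open>Zorn's lemma gives a maximal proper filter containing \<open>a\<close>. By
  \<open>proper_filter_extend\<close> it contains each \<open>c\<close> or its complement, and the
  remaining clauses follow from that.\<close>

lemma ultrafilter_exists:
  assumes a: "a \<in> carrier A" "a \<noteq> \<zero>"
  shows "\<exists>U. ultrafilter U \<and> a \<in> U"
proof -
  let ?S = "{F. proper_filter F \<and> a \<in> F}"
  \<comment> \<open>The principal filter of \<open>a\<close> makes the family for Zorn's lemma
    nonempty.\<close>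
  let ?P = "{x \<in> carrier A. a \<sqinter> x = a}"
  have P: "?P \<in> ?S"
    using a by (auto simp: proper_filter_def meet_idem meet_zero meet_closed)
      (metis meet_assoc)+
  have "\<exists>M\<in>?S. \<forall>X\<in>?S. M \<subseteq> X \<longrightarrow> X = M"
  proof (rule subset_Zorn_nonempty)
    show "?S \<noteq> {}" using P by blast
    fix C assume ne: "C \<noteq> {}" and C: "subset.chain ?S C"
    have filt: "proper_filter X" "a \<in> X" if "X \<in> C" for X
      using that C by (auto simp: subset.chain_def)
    have "x \<sqinter> y \<in> \<Union>C" if xy: "x \<in> \<Union>C" "y \<in> \<Union>C" for x y
    proof -
      obtain X Y where XY: "X \<in> C" "x \<in> X" "Y \<in> C" "y \<in> Y" using xy by blast
      then have "X \<subseteq> Y \<or> Y \<subseteq> X" using C unfolding subset.chain_def by blast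
      then show ?thesis
      proof
        assume "X \<subseteq> Y"
        then have "x \<sqinter> y \<in> Y" using XY filt(1)[of Y] unfolding proper_filter_def by blast
        then show ?thesis using XY by blast
      next
        assume "Y \<subseteq> X"
        then have "x \<sqinter> y \<in> X" using XY filt(1)[of X] unfolding proper_filter_def by blast
        then show ?thesis using XY by blast
      qed
    qed
    moreover have "\<Union>C \<subseteq> carrier A" "\<zero> \<notin> \<Union>C"
      "\<forall>x\<in>\<Union>C. \<forall>y\<in>carrier A. x \<sqinter> y = x \<longrightarrow> y \<in> \<Union>C"
      using filt(1) unfolding proper_filter_def by blast+
    moreover have "a \<in> \<Union>C" using ne filt(2) by blast
    ultimately show "\<Union>C \<in> ?S" unfolding proper_filter_def by blast
  qed
  then obtain M where M: "proper_filter M" "a \<in> M"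
    and max: "\<And>X. proper_filter X \<Longrightarrow> a \<in> X \<Longrightarrow> M \<subseteq> X \<Longrightarrow> X = M" by blast
  have MA: "x \<in> carrier A" if "x \<in> M" for x
    using M that unfolding proper_filter_def by blast
  have z: "\<zero> \<notin> M"
    using M unfolding proper_filter_def by blast
  have M_meet: "x \<sqinter> y \<in> M" if "x \<in> M" "y \<in> M" for x y
    using M that unfolding proper_filter_def by blast
  have M_up: "y \<in> M" if "x \<in> M" "y \<in> carrier A" "x \<sqinter> y = x" for x y
    using M that unfolding proper_filter_def by blast
  have ultra: "c \<in> M" if "c \<in> carrier A" "\<sim> c \<notin> M" for c
    using proper_filter_extend[OF M(1) _ that] max M(2) by blast
  have neg: "\<sim> x \<in> M \<longleftrightarrow> x \<notin> M" if "x \<in> carrier A" for x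
    using ultra[OF that] M_meet[of x "\<sim> x"] z meet_cmpl[OF that] by auto
  have meet: "x \<sqinter> y \<in> M \<longleftrightarrow> x \<in> M \<and> y \<in> M" if "x \<in> carrier A" "y \<in> carrier A" for x y
  proof
    assume xy: "x \<sqinter> y \<in> M"
    have "(x \<sqinter> y) \<sqinter> y = x \<sqinter> y" "(x \<sqinter> y) \<sqinter> x = x \<sqinter> y"
      using that by (metis meet_assoc meet_comm meet_idem)+
    then show "x \<in> M \<and> y \<in> M" using M_up[OF xy] that by blast
  qed (use M_meet in blast)
  have join: "x \<squnion> y \<in> M \<longleftrightarrow> x \<in> M \<or> y \<in> M" if xy: "x \<in> carrier A" "y \<in> carrier A" for x y
  proof
    assume j: "x \<squnion> y \<in> M"
    show "x \<in> M \<or> y \<in> M"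
    proof (rule ccontr)
      assume "\<not> (x \<in> M \<or> y \<in> M)"
      then have "\<sim> x \<sqinter> \<sim> y \<in> M" using neg xy M_meet by blast
      then have "(\<sim> x \<sqinter> \<sim> y) \<sqinter> (x \<squnion> y) \<in> M" using j M_meet by blast
      moreover have "(\<sim> x \<sqinter> \<sim> y) \<sqinter> x = \<zero>" "(\<sim> x \<sqinter> \<sim> y) \<sqinter> y = \<zero>"
        using xy by (metis cmpl_closed meet_assoc meet_cmpl meet_comm meet_zero)+
      ultimately show False
        using xy z by (simp add: meet_join_distrib cmpl_closed meet_closed join_zero zero_closed)
    qed
  next
    assume "x \<in> M \<or> y \<in> M"
    then show "x \<squnion> y \<in> M"
      using M_up xy by (metis join_closed join_comm meet_join_absorb)
  qed
  have "\<one> \<in> M" using M_up[OF M(2) one_closed] a meet_one by blast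
  then have "ultrafilter M"
    by (simp add: ultrafilter_def z neg meet join)
  then show ?thesis using M(2) by blast
qed

lemma mem_ultrafilter:
  assumes "ultrafilter U"
  shows "\<one> \<in> U" "\<zero> \<notin> U" "x \<in> carrier A \<Longrightarrow> \<sim> x \<in> U \<longleftrightarrow> x \<notin> U"
    "\<lbrakk>x \<in> carrier A; y \<in> carrier A\<rbrakk> \<Longrightarrow> x \<sqinter> y \<in> U \<longleftrightarrow> x \<in> U \<and> y \<in> U"
    "\<lbrakk>x \<in> carrier A; y \<in> carrier A\<rbrakk> \<Longrightarrow> x \<squnion> y \<in> U \<longleftrightarrow> x \<in> U \<or> y \<in> U"
  using assms by (simp_all add: ultrafilter_def)

text \<open>If \<open>a \<sqinter> \<sim> b\<close> is nonzero, some ultrafilter contains it, hence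
  contains \<open>a\<close> and omits \<open>b\<close>. With \<open>mem_ultrafilter\<close>,
  inequalities between terms become propositional checks.\<close>

lemma le_iff_ultrafilters:
  assumes "a \<in> carrier A" "b \<in> carrier A"
  shows "a \<sqsubseteq> b \<longleftrightarrow> (\<forall>U. ultrafilter U \<longrightarrow> a \<in> U \<longrightarrow> b \<in> U)"
proof
  assume "a \<sqsubseteq> b"
  then show "\<forall>U. ultrafilter U \<longrightarrow> a \<in> U \<longrightarrow> b \<in> U"
    using mem_ultrafilter(4) assms unfolding ble_def by metis
next
  assume R: "\<forall>U. ultrafilter U \<longrightarrow> a \<in> U \<longrightarrow> b \<in> U"
  have "a \<sqinter> \<sim> b = \<zero>"
  proof (rule ccontr)
    assume "a \<sqinter> \<sim> b \<noteq> \<zero>"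
    then obtain U where "ultrafilter U" "a \<sqinter> \<sim> b \<in> U"
      using ultrafilter_exists assms meet_closed cmpl_closed by blast
    then show False using R assms by (auto simp: mem_ultrafilter cmpl_closed)
  qed
  then show "a \<sqsubseteq> b"
    using meet_split[OF assms] assms by (simp add: ble_def join_zero meet_closed)
qed

lemma eq_iff_ultrafilters:
  assumes "a \<in> carrier A" "b \<in> carrier A"
  shows "a = b \<longleftrightarrow> (\<forall>U. ultrafilter U \<longrightarrow> (a \<in> U \<longleftrightarrow> b \<in> U))"
proof
  assume "\<forall>U. ultrafilter U \<longrightarrow> (a \<in> U \<longleftrightarrow> b \<in> U)"
  then have "a \<sqsubseteq> b" "b \<sqsubseteq> a" using assms by (simp_all add: le_iff_ultrafilters)
  then show "a = b" using assms unfolding ble_def by (metis meet_comm)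
qed blast

lemma cmpl_cmpl: "a \<in> carrier A \<Longrightarrow> \<sim> (\<sim> a) = a"
  by (simp add: eq_iff_ultrafilters cmpl_closed mem_ultrafilter)

lemma cmpl_one: "\<sim> \<one> = \<zero>"
  by (simp add: eq_iff_ultrafilters cmpl_closed one_closed zero_closed mem_ultrafilter)

lemma cmpl_zero: "\<sim> \<zero> = \<one>"
  by (simp add: eq_iff_ultrafilters cmpl_closed one_closed zero_closed mem_ultrafilter)

end

section \<open>Laws of \<open>\<prec>\<close> in the form of the axioms of the calculus\<close>

context contact_algebra
begin

lemma prec_mono_left:
  "\<lbrakk>a \<in> carrier A; b \<in> carrier A; c \<in> carrier A; a \<sqsubseteq> b; b \<prec> c\<rbrakk> \<Longrightarrow> a \<prec> c"
  using prec_mono[of a b c c] by (simp add: le_iff_ultrafilters)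

lemma prec_mono_right:
  "\<lbrakk>a \<in> carrier A; b \<in> carrier A; c \<in> carrier A; a \<prec> b; b \<sqsubseteq> c\<rbrakk> \<Longrightarrow> a \<prec> c"
  using prec_mono[of a a b c] by (simp add: le_iff_ultrafilters)

lemma zero_prec: "a \<in> carrier A \<Longrightarrow> \<zero> \<prec> a"
  using prec_mono_right[OF _ _ _ prec_zero] by (simp add: le_iff_ultrafilters zero_closed mem_ultrafilter)

lemma prec_one_right: "a \<in> carrier A \<Longrightarrow> a \<prec> \<one>"
  using prec_mono_left[OF _ _ _ _ prec_one] by (simp add: le_iff_ultrafilters one_closed mem_ultrafilter)

text \<open>Hence an \<open>AllBox\<close> formula takes the value \<one> if its argument does, and
  \<zero> otherwise.\<close>

lemma one_prec_iff: "a \<in> carrier A \<Longrightarrow> \<one> \<prec> a \<longleftrightarrow> a = \<one>"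
  using prec_le[OF one_closed, of a] prec_one one_meet[of a] by (auto simp: ble_def)

lemma prec_cmpl_iff: "\<lbrakk>a \<in> carrier A; b \<in> carrier A\<rbrakk> \<Longrightarrow> \<sim> b \<prec> \<sim> a \<longleftrightarrow> a \<prec> b"
  using prec_cmpl[of a b] prec_cmpl[of "\<sim> b" "\<sim> a"] by (auto simp: cmpl_closed cmpl_cmpl)

lemma join_prec_iff:
  assumes "a \<in> carrier A" "b \<in> carrier A" "c \<in> carrier A"
  shows "a \<squnion> b \<prec> c \<longleftrightarrow> a \<prec> c \<and> b \<prec> c"
proof -
  have "a \<sqsubseteq> a \<squnion> b" "b \<sqsubseteq> a \<squnion> b" "a \<squnion> b \<in> carrier A"
    using assms by (simp_all add: le_iff_ultrafilters join_closed mem_ultrafilter)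
  then show ?thesis using assms prec_join[of a b c] prec_mono_left[of _ "a \<squnion> b" c] by blast
qed

lemma prec_meet_iff:
  assumes "a \<in> carrier A" "b \<in> carrier A" "c \<in> carrier A"
  shows "a \<prec> b \<sqinter> c \<longleftrightarrow> a \<prec> b \<and> a \<prec> c"
proof -
  have "b \<sqinter> c \<sqsubseteq> b" "b \<sqinter> c \<sqsubseteq> c" "b \<sqinter> c \<in> carrier A"
    using assms by (simp_all add: le_iff_ultrafilters meet_closed mem_ultrafilter)
  then show ?thesis using assms prec_meet[of a b c] prec_mono_right[of a "b \<sqinter> c"] by blast
qed

end

context compingent_algebra
begin

text \<open>If \<open>a\<close> were not below \<open>u\<close>, some nonzero \<open>b\<close> would
  be well below \<open>a \<sqinter> \<sim> u\<close>, and so below both \<open>u\<close> and its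
  complement. Soundness of \<open>Rule_join\<close> rests on this.\<close>

lemma le_if_prec_below_le:
  assumes a: "a \<in> carrier A" and u: "u \<in> carrier A"
    and le: "\<And>b. b \<in> carrier A \<Longrightarrow> b \<prec> a \<Longrightarrow> b \<sqsubseteq> u"
  shows "a \<sqsubseteq> u"
proof (rule ccontr)
  let ?d = "a \<sqinter> \<sim> u"
  assume "\<not> a \<sqsubseteq> u"
  then have d: "?d \<in> carrier A" "?d \<noteq> \<zero>"
    using a u by (auto simp: le_iff_ultrafilters eq_iff_ultrafilters meet_closed cmpl_closed zero_closed mem_ultrafilter)
  then obtain b where b: "b \<in> carrier A" "b \<noteq> \<zero>" "b \<prec> ?d" using prec_below by blast
  then have "b \<prec> a" using a u by (simp add: prec_meet_iff cmpl_closed)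
  then have "b \<sqsubseteq> u" using b le by blast
  moreover have "b \<sqsubseteq> ?d" using b d prec_le by blast
  ultimately show False
    using a u b by (auto simp: le_iff_ultrafilters eq_iff_ultrafilters meet_closed cmpl_closed zero_closed mem_ultrafilter)
qed

end

section \<open>The modality, evaluation of formulas, and soundness\<close>

context upper_continuous_modal_compingent_algebra
begin

lemmas closed = meet_closed join_closed cmpl_closed zero_closed one_closed dia_closed

lemma dia_le:
  assumes "a \<in> carrier A" "b \<in> carrier A" "a \<prec> b"
  shows "\<diamond> a \<sqsubseteq> \<diamond> b"
  using dia_upper_continuous[OF assms(1)] assms unfolding is_meet_of_def by blast

lemma le_dia:
  assumes "a \<in> carrier A" "l \<in> carrier A" "\<And>b. b \<in> carrier A \<Longrightarrow> a \<prec> b \<Longrightarrow> l \<sqsubseteq> \<diamond> b"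
  shows "l \<sqsubseteq> \<diamond> a"
  using dia_upper_continuous[OF assms(1)] assms unfolding is_meet_of_def by blast

text \<open>De Vries additivity speaks only of \<open>\<prec>\<close>. Upper continuity extends it
  to \<open>\<sqsubseteq>\<close>, since every \<open>c\<close> with \<open>b \<prec> c\<close> also
  satisfies \<open>a \<prec> c\<close>.\<close>

lemma dia_mono:
  assumes "a \<in> carrier A" "b \<in> carrier A" "a \<sqsubseteq> b"
  shows "\<diamond> a \<sqsubseteq> \<diamond> b"
proof (rule le_dia)
  fix c assume "c \<in> carrier A" "b \<prec> c"
  then show "\<diamond> a \<sqsubseteq> \<diamond> c" using assms dia_le prec_mono_left by blast
qed (use assms in \<open>simp_all add: closed\<close>)

lemma dia_prec:
  assumes "a \<in> carrier A" "b \<in> carrier A" "a \<prec> b"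
  shows "\<diamond> a \<prec> \<diamond> b"
  using dia_additive[of a b a b] assms by (simp add: join_idem closed)

text \<open>For \<open>c\<close> and \<open>d\<close> well above \<open>a\<close> and
  \<open>b\<close>, additivity bounds the left side by
  \<open>\<diamond> c \<squnion> \<diamond> d\<close>. Upper continuity then replaces
  \<open>c\<close> by \<open>a\<close> and \<open>d\<close> by \<open>b\<close>, one at a time; the
  other disjunct waits on the left as a complement, which stands in for distributing the join over
  an infinite meet.\<close>

lemma dia_join_le:
  assumes a: "a \<in> carrier A" and b: "b \<in> carrier A"
  shows "\<diamond> (a \<squnion> b) \<sqsubseteq> \<diamond> a \<squnion> \<diamond> b"
proof -
  let ?x = "\<diamond> (a \<squnion> b)"
  have 1: "?x \<sqsubseteq> \<diamond> c \<squnion> \<diamond> d" if "c \<in> carrier A" "d \<in> carrier A" "a \<prec> c" "b \<prec> d" for c d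
    using that a b by (intro prec_le dia_additive closed)
  have 2: "?x \<sqinter> \<sim> (\<diamond> d) \<sqsubseteq> \<diamond> a" if d: "d \<in> carrier A" "b \<prec> d" for d
  proof (rule le_dia)
    fix c assume c: "c \<in> carrier A" "a \<prec> c"
    then show "?x \<sqinter> \<sim> (\<diamond> d) \<sqsubseteq> \<diamond> c"
      using 1[of c d] a b d by (auto simp: le_iff_ultrafilters mem_ultrafilter closed)
  qed (use a b d in \<open>simp_all add: closed\<close>)
  have "?x \<sqinter> \<sim> (\<diamond> a) \<sqsubseteq> \<diamond> b"
  proof (rule le_dia)
    fix d assume d: "d \<in> carrier A" "b \<prec> d"
    then show "?x \<sqinter> \<sim> (\<diamond> a) \<sqsubseteq> \<diamond> d"
      using 2[of d] a b by (auto simp: le_iff_ultrafilters mem_ultrafilter closed)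
  qed (use a b in \<open>simp_all add: closed\<close>)
  then show ?thesis using a b by (auto simp: le_iff_ultrafilters mem_ultrafilter closed)
qed

lemma eval_closed: "range v \<subseteq> carrier A \<Longrightarrow> eval A v \<phi> \<in> carrier A"
  by (induction \<phi>) (auto simp: closed)

lemma eval_cong_vars: "(\<And>p. p \<in> vars \<phi> \<Longrightarrow> v p = v' p) \<Longrightarrow> eval A v \<phi> = eval A v' \<phi>"
  by (induction \<phi>) simp_all

lemma eval_fun_upd_fresh: "p \<notin> vars \<phi> \<Longrightarrow> eval A (v(p := c)) \<phi> = eval A v \<phi>"
  by (rule eval_cong_vars) auto

text \<open>An ultrafilter turns a valuation into a truth assignment whose atoms include strict
  implications and boxed formulas, so instances of tautologies lie in every ultrafilter.\<close>

lemma eval_mem_ultrafilter: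
  assumes "ultrafilter U" "range v \<subseteq> carrier A"
  shows "eval A v \<phi> \<in> U \<longleftrightarrow> prop_eval (\<lambda>\<psi>. eval A v \<psi> \<in> U) \<phi>"
proof (induction \<phi>)
qed (use assms in \<open>auto simp: mem_ultrafilter closed eval_closed\<close>)

lemma eval_Imp_eq_one_iff:
  assumes "range v \<subseteq> carrier A"
  shows "eval A v (\<phi> \<^bold>\<rightarrow> \<psi>) = \<one> \<longleftrightarrow> eval A v \<phi> \<sqsubseteq> eval A v \<psi>"
  using eval_closed[OF assms, of \<phi>] eval_closed[OF assms, of \<psi>]
  by (auto simp: eq_iff_ultrafilters le_iff_ultrafilters mem_ultrafilter closed)

lemma eval_Iff_eq_one_iff:
  assumes "range v \<subseteq> carrier A"
  shows "eval A v (\<phi> \<^bold>\<leftrightarrow> \<psi>) = \<one> \<longleftrightarrow> eval A v \<phi> = eval A v \<psi>"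
  using eval_closed[OF assms, of \<phi>] eval_closed[OF assms, of \<psi>]
  by (auto simp: eq_iff_ultrafilters mem_ultrafilter closed)

text \<open>The valuation is generalized in the induction because the three variable rules use the
  hypothesis at a valuation changed at \<open>p\<close>.\<close>

lemma soundness:
  assumes "MS2IC_u \<phi>" "range v \<subseteq> carrier A"
  shows "eval A v \<phi> = \<one>"
  using assms
proof (induction arbitrary: v rule: MS2IC_u.induct)
  case (Taut \<phi>)
  then have "eval A v \<phi> \<in> U" if "ultrafilter U" for U
    using eval_mem_ultrafilter[OF that] unfolding tautology_instance_def by blast
  then show ?case
    using Taut.prems by (simp add: eq_iff_ultrafilters eval_closed closed mem_ultrafilter)
next
  case (A1 \<phi>)
  then show ?case by (simp add: eval_closed zero_prec prec_one_right meet_one one_closed)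
next
  case (A2 \<phi> \<psi> \<chi>)
  then show ?case
    by (subst eval_Iff_eq_one_iff) (auto simp: eval_closed join_prec_iff meet_one meet_zero
        one_meet closed)
next
  case (A3 \<phi> \<psi> \<chi>)
  then show ?case
    by (subst eval_Iff_eq_one_iff) (auto simp: eval_closed prec_meet_iff meet_one meet_zero
        one_meet closed)
next
  case (A4 \<phi> \<psi>)
  then show ?case
    using prec_le[of "eval A v \<phi>" "eval A v \<psi>"]
    by (subst eval_Imp_eq_one_iff) (auto simp: eval_closed le_iff_ultrafilters closed mem_ultrafilter)
next
  case (A5 \<phi> \<psi>)
  then show ?case by (subst eval_Iff_eq_one_iff) (auto simp: eval_closed prec_cmpl_iff)
next
  case (A8 \<phi>)
  then show ?case
    by (subst eval_Imp_eq_one_iff) (auto simp: eval_closed le_iff_ultrafilters closed mem_ultrafilter prec_one)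
next
  case (A9 \<phi>)
  then show ?case
    by (subst eval_Imp_eq_one_iff)
      (auto simp: eval_closed le_iff_ultrafilters closed mem_ultrafilter one_prec_iff eq_iff_ultrafilters)
next
  case (A10 \<phi> \<psi>)
  then show ?case
    by (subst eval_Iff_eq_one_iff)
      (auto simp: eval_closed closed one_prec_iff)
next
  case (A11 \<phi>)
  then show ?case
    by (subst eval_Imp_eq_one_iff)
      (auto simp: eval_closed le_iff_ultrafilters closed mem_ultrafilter one_prec_iff cmpl_one prec_zero)
next
  case (K \<phi> \<psi>)
  let ?a = "eval A v \<phi>" and ?b = "eval A v \<psi>"
  have ab: "?a \<in> carrier A" "?b \<in> carrier A" using K eval_closed by auto
  \<comment> \<open>\<open>K\<close> in dual form: \<open>\<sim> ?b\<close> lies below the join of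
    the complements of \<open>\<sim> ?a \<squnion> ?b\<close> and of \<open>?a\<close>.\<close>
  then have "\<diamond> (\<sim> ?b) \<sqsubseteq> \<diamond> ((\<sim> (\<sim> ?a \<squnion> ?b)) \<squnion> \<sim> ?a)"
    by (intro dia_mono closed) (auto simp: le_iff_ultrafilters mem_ultrafilter closed)
  moreover have "\<diamond> ((\<sim> (\<sim> ?a \<squnion> ?b)) \<squnion> \<sim> ?a) \<sqsubseteq> \<diamond> (\<sim> (\<sim> ?a \<squnion> ?b)) \<squnion> \<diamond> (\<sim> ?a)"
    using ab by (intro dia_join_le closed)
  ultimately show ?case
    using ab by (auto simp: le_iff_ultrafilters eq_iff_ultrafilters mem_ultrafilter closed)
next
  case (Add \<phi> \<psi>)
  let ?a = "eval A v \<phi>" and ?b = "eval A v \<psi>"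
  have ab: "?a \<in> carrier A" "?b \<in> carrier A" using Add eval_closed by auto
  then have "?a \<prec> ?b \<Longrightarrow> \<sim> (\<diamond> (\<sim> ?a)) \<prec> \<sim> (\<diamond> (\<sim> ?b))"
    by (intro prec_cmpl dia_prec closed)
  with Add show ?case
    by (subst eval_Imp_eq_one_iff) (auto simp: le_iff_ultrafilters mem_ultrafilter closed)
next
  case (MP \<phi> \<psi>)
  then have "eval A v \<phi> \<sqsubseteq> eval A v \<psi>" "eval A v \<phi> = \<one>"
    using eval_Imp_eq_one_iff by blast+
  then show ?case using MP.prems by (auto simp: le_iff_ultrafilters eq_iff_ultrafilters eval_closed closed mem_ultrafilter)
next
  case (Nec_All \<phi>)
  then show ?case by (simp add: prec_one)
next
  case (Nec_Box \<phi>)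
  then show ?case by (simp add: dia_zero cmpl_one cmpl_zero)
next
  case (Congr \<phi> \<psi> \<chi>)
  then have "eval A v \<phi> = eval A v \<psi>" using eval_Iff_eq_one_iff by blast
  with Congr show ?case by (subst eval_Iff_eq_one_iff) auto
next
  case (Rule_density \<phi> p \<psi> \<chi>)
  show ?case
  proof (cases "eval A v \<phi> \<prec> eval A v \<psi>")
    case True
    \<comment> \<open>An interpolant becomes the value of the fresh variable.\<close>
    then obtain c where c: "c \<in> carrier A" "eval A v \<phi> \<prec> c" "c \<prec> eval A v \<psi>"
      using prec_dense eval_closed Rule_density.prems by metis
    then have v: "range (v(p := c)) \<subseteq> carrier A" using Rule_density.prems by auto
    then have "eval A (v(p := c)) ((\<phi> \<^bold>\<leadsto> Var p) \<^bold>\<and> (Var p \<^bold>\<leadsto> \<psi>)) \<sqsubseteq> eval A (v(p := c)) \<chi>"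
      using Rule_density.IH eval_Imp_eq_one_iff by blast
    then show ?thesis
      using c Rule_density True
      by (subst eval_Imp_eq_one_iff) (auto simp: eval_fun_upd_fresh meet_one closed)
  next
    case False
    with Rule_density show ?thesis
      by (subst eval_Imp_eq_one_iff) (auto simp: le_iff_ultrafilters eval_closed closed mem_ultrafilter)
  qed
next
  case (Rule_join p \<phi> \<chi>)
  have "eval A v \<phi> \<sqsubseteq> eval A v \<chi>"
  proof (rule le_if_prec_below_le)
    fix b assume b: "b \<in> carrier A" "b \<prec> eval A v \<phi>"
    then have v: "range (v(p := b)) \<subseteq> carrier A" using Rule_join.prems by auto
    then have "eval A (v(p := b)) ((Var p \<^bold>\<leadsto> \<phi>) \<^bold>\<and> Var p) \<sqsubseteq> eval A (v(p := b)) \<chi>"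
      using Rule_join.IH eval_Imp_eq_one_iff by blast
    then show "b \<sqsubseteq> eval A v \<chi>"
      using b Rule_join.hyps Rule_join.prems
      by (auto simp: eval_fun_upd_fresh le_iff_ultrafilters eval_closed closed mem_ultrafilter)
  qed (use Rule_join.prems in \<open>simp_all add: eval_closed\<close>)
  then show ?case using eval_Imp_eq_one_iff Rule_join.prems by blast
next
  case (Rule_upper p \<phi> \<psi>)
  let ?a = "eval A v \<phi>" and ?u = "eval A v \<psi>"
  have au: "?a \<in> carrier A" "?u \<in> carrier A" using eval_closed Rule_upper.prems by auto
  \<comment> \<open>The contrapositive of the goal, so that \<open>le_dia\<close> applies. An
    element \<open>d\<close> well above \<open>\<sim> ?a\<close> yields \<open>\<sim> d\<close> well
    below \<open>?a\<close>, and \<open>\<sim> d\<close> is the value given to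
    \<open>p\<close>.\<close>
  have "\<sim> ?u \<sqsubseteq> \<diamond> (\<sim> ?a)"
  proof (rule le_dia)
    fix d assume d: "d \<in> carrier A" "\<sim> ?a \<prec> d"
    then have b: "\<sim> d \<prec> ?a" using prec_cmpl_iff[of "\<sim> d" ?a] au by (simp add: closed cmpl_cmpl)
    have v: "range (v(p := \<sim> d)) \<subseteq> carrier A" using Rule_upper.prems d cmpl_closed by auto
    then have "eval A (v(p := \<sim> d)) ((Var p \<^bold>\<leadsto> \<phi>) \<^bold>\<and> \<^bold>\<box> (Var p)) \<sqsubseteq> eval A (v(p := \<sim> d)) \<psi>"
      using Rule_upper.IH eval_Imp_eq_one_iff by blast
    then show "\<sim> ?u \<sqsubseteq> \<diamond> d"
      using b d au Rule_upper.hyps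
      by (auto simp: eval_fun_upd_fresh le_iff_ultrafilters eval_closed closed mem_ultrafilter cmpl_cmpl)
  qed (use au in \<open>simp_all add: closed\<close>)
  then show ?case
    using Rule_upper.prems au
    by (subst eval_Imp_eq_one_iff) (auto simp: le_iff_ultrafilters closed mem_ultrafilter)
qed

end

section \<open>Derivations and rich theories\<close>

text \<open>This lemma and the next three replace Hilbert-style propositional derivations by a
  truth-table check: tautological consequences of up to three theorems are theorems.\<close>

lemma MS2IC_u_conseq0: "(\<And>w. prop_eval w \<phi>) \<Longrightarrow> MS2IC_u \<phi>"
  by (rule Taut) (simp add: tautology_instance_def)

lemma MS2IC_u_conseq1:
  assumes "MS2IC_u \<phi>" "\<And>w. prop_eval w \<phi> \<Longrightarrow> prop_eval w \<chi>"
  shows "MS2IC_u \<chi>"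
  by (rule MP[OF MS2IC_u_conseq0 assms(1)]) (simp add: assms(2))

lemma MS2IC_u_conseq2:
  assumes "MS2IC_u \<phi>" "MS2IC_u \<psi>" "\<And>w. prop_eval w \<phi> \<Longrightarrow> prop_eval w \<psi> \<Longrightarrow> prop_eval w \<chi>"
  shows "MS2IC_u \<chi>"
  by (rule MP[OF MS2IC_u_conseq1[OF assms(1)] assms(2)]) (simp add: assms(3))

lemma MS2IC_u_conseq3:
  assumes "MS2IC_u \<phi>" "MS2IC_u \<psi>" "MS2IC_u \<theta>"
    "\<And>w. prop_eval w \<phi> \<Longrightarrow> prop_eval w \<psi> \<Longrightarrow> prop_eval w \<theta> \<Longrightarrow> prop_eval w \<chi>"
  shows "MS2IC_u \<chi>"
  by (rule MP[OF MS2IC_u_conseq2[OF assms(1,2)] assms(3)]) (simp add: assms(4))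

section \<open>Derived laws of strict implication and of the two modalities\<close>

lemma SImp_mono_left:
  assumes "MS2IC_u (\<phi> \<^bold>\<rightarrow> \<psi>)"
  shows "MS2IC_u ((\<psi> \<^bold>\<leadsto> \<chi>) \<^bold>\<rightarrow> (\<phi> \<^bold>\<leadsto> \<chi>))"
proof -
  \<comment> \<open>The implication is rewritten as an equivalence with a disjunction, where
    \<open>Congr\<close> and \<open>A2\<close> apply.\<close>
  have "MS2IC_u (\<psi> \<^bold>\<leftrightarrow> (\<phi> \<^bold>\<or> \<psi>))" by (rule MS2IC_u_conseq1[OF assms]) auto
  from Congr[OF this] show ?thesis by (rule MS2IC_u_conseq2[OF _ A2]) auto
qed

lemma SImp_mono_right:
  assumes "MS2IC_u (\<psi> \<^bold>\<rightarrow> \<chi>)"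
  shows "MS2IC_u ((\<phi> \<^bold>\<leadsto> \<psi>) \<^bold>\<rightarrow> (\<phi> \<^bold>\<leadsto> \<chi>))"
proof -
  have "MS2IC_u (\<^bold>\<not> \<chi> \<^bold>\<rightarrow> \<^bold>\<not> \<psi>)" by (rule MS2IC_u_conseq1[OF assms]) auto
  from SImp_mono_left[OF this] show ?thesis
    by (rule MS2IC_u_conseq3[OF _ A5[of \<phi> \<psi>] A5[of \<phi> \<chi>]]) auto
qed

lemma AllBox_T: "MS2IC_u (\<^bold>[\<^bold>\<forall>\<^bold>] \<phi> \<^bold>\<rightarrow> \<phi>)"
  by (rule MS2IC_u_conseq1[OF A4[of "\<^bold>\<top>" \<phi>]]) auto

lemma AllBox_K: "MS2IC_u (\<^bold>[\<^bold>\<forall>\<^bold>] (\<phi> \<^bold>\<rightarrow> \<psi>) \<^bold>\<rightarrow> (\<^bold>[\<^bold>\<forall>\<^bold>] \<phi> \<^bold>\<rightarrow> \<^bold>[\<^bold>\<forall>\<^bold>] \<psi>))"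
proof -
  have "MS2IC_u (((\<phi> \<^bold>\<rightarrow> \<psi>) \<^bold>\<and> \<phi>) \<^bold>\<rightarrow> \<psi>)" by (rule MS2IC_u_conseq0) auto
  from SImp_mono_right[OF this, of "\<^bold>\<top>"] show ?thesis
    by (rule MS2IC_u_conseq2[OF _ A3[of "\<^bold>\<top>" "\<phi> \<^bold>\<rightarrow> \<psi>" \<phi>]]) auto
qed

lemma AllBox_mono:
  assumes "MS2IC_u (\<phi> \<^bold>\<rightarrow> \<psi>)"
  shows "MS2IC_u (\<^bold>[\<^bold>\<forall>\<^bold>] \<phi> \<^bold>\<rightarrow> \<^bold>[\<^bold>\<forall>\<^bold>] \<psi>)"
  using assms by (rule SImp_mono_right)

text \<open>\<open>Add\<close> changes the antecedent \<top> into \<box>\<top>, which is a theorem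
  and therefore implied by \<top>.\<close>

lemma AllBox_Box: "MS2IC_u (\<^bold>[\<^bold>\<forall>\<^bold>] \<phi> \<^bold>\<rightarrow> \<^bold>[\<^bold>\<forall>\<^bold>] (\<^bold>\<box> \<phi>))"
proof -
  have "MS2IC_u \<^bold>\<top>" by (rule MS2IC_u_conseq0) auto
  then have "MS2IC_u (\<^bold>\<box> \<^bold>\<top>)" by (rule Nec_Box)
  then have "MS2IC_u (\<^bold>\<top> \<^bold>\<rightarrow> \<^bold>\<box> \<^bold>\<top>)" by (rule MS2IC_u_conseq1) auto
  from SImp_mono_left[OF this] show ?thesis by (rule MS2IC_u_conseq2[OF Add[of "\<^bold>\<top>" \<phi>]]) auto
qed

lemma Box_mono:
  assumes "MS2IC_u (\<phi> \<^bold>\<rightarrow> \<psi>)"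
  shows "MS2IC_u (\<^bold>\<box> \<phi> \<^bold>\<rightarrow> \<^bold>\<box> \<psi>)"
  using MP[OF K Nec_Box[OF assms]] .

lemma Box_And: "MS2IC_u (\<^bold>\<box> \<phi> \<^bold>\<rightarrow> \<^bold>\<box> \<psi> \<^bold>\<rightarrow> \<^bold>\<box> (\<phi> \<^bold>\<and> \<psi>))"
proof -
  have "MS2IC_u (\<phi> \<^bold>\<rightarrow> \<psi> \<^bold>\<rightarrow> (\<phi> \<^bold>\<and> \<psi>))" by (rule MS2IC_u_conseq0) auto
  from Box_mono[OF this] show ?thesis by (rule MS2IC_u_conseq2[OF _ K[of \<psi> "\<phi> \<^bold>\<and> \<psi>"]]) auto
qed

text \<open>Axiom \<open>A11\<close> gives \<open>\<not>[\<forall>]\<theta> \<leadsto> \<chi>\<close> from \<open>[\<forall>]\<theta>\<close>, for \<open>\<theta> = (\<phi> \<rightarrow> \<psi>)\<close>, and \<open>\<phi>\<close> entails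
  \<open>\<psi> \<or> \<not>[\<forall>]\<theta>\<close>.\<close>

lemma AllBox_SImp_left: "MS2IC_u (\<^bold>[\<^bold>\<forall>\<^bold>] (\<phi> \<^bold>\<rightarrow> \<psi>) \<^bold>\<rightarrow> ((\<psi> \<^bold>\<leadsto> \<chi>) \<^bold>\<rightarrow> (\<phi> \<^bold>\<leadsto> \<chi>)))"
proof -
  let ?n = "\<^bold>\<not> (\<^bold>[\<^bold>\<forall>\<^bold>] (\<phi> \<^bold>\<rightarrow> \<psi>))"
  have "MS2IC_u (\<^bold>\<bottom> \<^bold>\<rightarrow> \<chi>)" by (rule MS2IC_u_conseq0) auto
  from SImp_mono_right[OF this, of ?n]
  have n: "MS2IC_u (\<^bold>[\<^bold>\<forall>\<^bold>] (\<phi> \<^bold>\<rightarrow> \<psi>) \<^bold>\<rightarrow> (?n \<^bold>\<leadsto> \<chi>))"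
    by (rule MS2IC_u_conseq2[OF A11]) auto
  have "MS2IC_u (\<phi> \<^bold>\<rightarrow> (\<psi> \<^bold>\<or> ?n))"
    by (rule MS2IC_u_conseq1[OF AllBox_T[of "\<phi> \<^bold>\<rightarrow> \<psi>"]]) auto
  from SImp_mono_left[OF this] show ?thesis
    by (rule MS2IC_u_conseq3[OF _ n A2[of \<psi> ?n \<chi>]]) auto
qed

lemma AllBox_SImp_right: "MS2IC_u (\<^bold>[\<^bold>\<forall>\<^bold>] (\<psi> \<^bold>\<rightarrow> \<chi>) \<^bold>\<rightarrow> ((\<phi> \<^bold>\<leadsto> \<psi>) \<^bold>\<rightarrow> (\<phi> \<^bold>\<leadsto> \<chi>)))"
proof -
  have "MS2IC_u ((\<psi> \<^bold>\<rightarrow> \<chi>) \<^bold>\<rightarrow> (\<^bold>\<not> \<chi> \<^bold>\<rightarrow> \<^bold>\<not> \<psi>))" by (rule MS2IC_u_conseq0) auto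
  from AllBox_mono[OF this]
  have "MS2IC_u (\<^bold>[\<^bold>\<forall>\<^bold>] (\<psi> \<^bold>\<rightarrow> \<chi>) \<^bold>\<rightarrow> ((\<^bold>\<not> \<psi> \<^bold>\<leadsto> \<^bold>\<not> \<phi>) \<^bold>\<rightarrow> (\<^bold>\<not> \<chi> \<^bold>\<leadsto> \<^bold>\<not> \<phi>)))"
    by (rule MS2IC_u_conseq2[OF _ AllBox_SImp_left[of "\<^bold>\<not> \<chi>" "\<^bold>\<not> \<psi>" "\<^bold>\<not> \<phi>"]]) auto
  then show ?thesis
    by (rule MS2IC_u_conseq3[OF _ A5[of \<phi> \<psi>] A5[of \<phi> \<chi>]]) auto
qed

text \<open>By \<open>A10\<close> and \<open>A9\<close> both conjuncts of the antecedent imply their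
  own \<open>AllBox\<close>, so the antecedent survives necessitation of the implication.\<close>

lemma AllBox_lift:
  assumes "MS2IC_u ((\<alpha> \<^bold>\<leadsto> \<beta>) \<^bold>\<and> \<^bold>\<not> (\<^bold>[\<^bold>\<forall>\<^bold>] \<theta>) \<^bold>\<rightarrow> \<chi>)"
  shows "MS2IC_u ((\<alpha> \<^bold>\<leadsto> \<beta>) \<^bold>\<and> \<^bold>\<not> (\<^bold>[\<^bold>\<forall>\<^bold>] \<theta>) \<^bold>\<rightarrow> \<^bold>[\<^bold>\<forall>\<^bold>] \<chi>)"
proof -
  let ?h = "(\<alpha> \<^bold>\<leadsto> \<beta>) \<^bold>\<and> \<^bold>\<not> (\<^bold>[\<^bold>\<forall>\<^bold>] \<theta>)"
  have "MS2IC_u (?h \<^bold>\<rightarrow> \<^bold>[\<^bold>\<forall>\<^bold>] ?h)"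
    by (rule MS2IC_u_conseq3[OF A10[of \<alpha> \<beta>] A9[of \<theta>] A3[of "\<^bold>\<top>" "\<alpha> \<^bold>\<leadsto> \<beta>" "\<^bold>\<not> (\<^bold>[\<^bold>\<forall>\<^bold>] \<theta>)"]]) auto
  then show ?thesis by (rule MS2IC_u_conseq2[OF _ AllBox_mono[OF assms]]) auto
qed

text \<open>One direction of the S5 adjunction between the dual of \<open>AllBox\<close> and
  \<open>AllBox\<close>: contrapose, necessitate, and apply \<open>A9\<close>.\<close>

lemma AllBox_dual:
  assumes "MS2IC_u (\<^bold>\<not> \<theta> \<^bold>\<rightarrow> \<^bold>[\<^bold>\<forall>\<^bold>] \<chi>)"
  shows "MS2IC_u (\<^bold>\<not> (\<^bold>[\<^bold>\<forall>\<^bold>] \<theta>) \<^bold>\<rightarrow> \<chi>)"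
proof -
  have "MS2IC_u (\<^bold>\<not> (\<^bold>[\<^bold>\<forall>\<^bold>] \<chi>) \<^bold>\<rightarrow> \<theta>)" by (rule MS2IC_u_conseq1[OF assms]) auto
  from AllBox_mono[OF this] show ?thesis
    by (rule MS2IC_u_conseq3[OF _ A9[of \<chi>] AllBox_T[of \<chi>]]) auto
qed

text \<open>That a formula has a nonzero class is expressed by a negated \<open>AllBox\<close>, so
  the witness rule is needed in this shape. \<open>AllBox_lift\<close> puts \<open>AllBox\<close> on
  the conclusion, \<open>Rule_join\<close> removes \<open>p\<close>, and \<open>AllBox_dual\<close>
  strips the \<open>AllBox\<close> again.\<close>

lemma Rule_join_AllBox:
  assumes "MS2IC_u ((Var p \<^bold>\<leadsto> \<phi>) \<^bold>\<and> \<^bold>\<not> (\<^bold>[\<^bold>\<forall>\<^bold>] (\<^bold>\<not> Var p)) \<^bold>\<rightarrow> \<chi>)" "p \<notin> vars \<phi> \<union> vars \<chi>"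
  shows "MS2IC_u (\<^bold>\<not> (\<^bold>[\<^bold>\<forall>\<^bold>] (\<^bold>\<not> \<phi>)) \<^bold>\<rightarrow> \<chi>)"
proof (rule AllBox_dual)
  have "MS2IC_u ((Var p \<^bold>\<leadsto> \<phi>) \<^bold>\<and> Var p \<^bold>\<rightarrow> \<^bold>[\<^bold>\<forall>\<^bold>] \<chi>)"
    by (rule MS2IC_u_conseq2[OF AllBox_lift[OF assms(1)] AllBox_T[of "\<^bold>\<not> Var p"]]) auto
  then have "MS2IC_u (\<phi> \<^bold>\<rightarrow> \<^bold>[\<^bold>\<forall>\<^bold>] \<chi>)"
    by (rule Rule_join) (use assms(2) in auto)
  then show "MS2IC_u (\<^bold>\<not> \<^bold>\<not> \<phi> \<^bold>\<rightarrow> \<^bold>[\<^bold>\<forall>\<^bold>] \<chi>)" by (rule MS2IC_u_conseq1) auto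
qed

text \<open>The same detour as for \<open>Rule_join_AllBox\<close>. The side formula
  \<open>\<psi>\<close> is kept as a disjunct on the right, so that the antecedent has exactly the
  shape \<open>Rule_upper\<close> expects.\<close>

lemma Rule_upper_AllBox:
  assumes "MS2IC_u ((Var p \<^bold>\<leadsto> \<phi>) \<^bold>\<and> \<^bold>\<not> (\<^bold>[\<^bold>\<forall>\<^bold>] (\<^bold>\<box> (Var p) \<^bold>\<rightarrow> \<psi>)) \<^bold>\<rightarrow> \<chi>)"
    and "p \<notin> vars \<phi> \<union> vars \<psi> \<union> vars \<chi>"
  shows "MS2IC_u (\<^bold>\<not> (\<^bold>[\<^bold>\<forall>\<^bold>] (\<^bold>\<box> \<phi> \<^bold>\<rightarrow> \<psi>)) \<^bold>\<rightarrow> \<chi>)"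
proof (rule AllBox_dual)
  have "MS2IC_u ((Var p \<^bold>\<leadsto> \<phi>) \<^bold>\<and> \<^bold>\<box> (Var p) \<^bold>\<rightarrow> \<psi> \<^bold>\<or> \<^bold>[\<^bold>\<forall>\<^bold>] \<chi>)"
    by (rule MS2IC_u_conseq2[OF AllBox_lift[OF assms(1)] AllBox_T[of "\<^bold>\<box> (Var p) \<^bold>\<rightarrow> \<psi>"]]) auto
  then have "MS2IC_u (\<^bold>\<box> \<phi> \<^bold>\<rightarrow> \<psi> \<^bold>\<or> \<^bold>[\<^bold>\<forall>\<^bold>] \<chi>)"
    by (rule Rule_upper) (use assms(2) in auto)
  then show "MS2IC_u (\<^bold>\<not> (\<^bold>\<box> \<phi> \<^bold>\<rightarrow> \<psi>) \<^bold>\<rightarrow> \<^bold>[\<^bold>\<forall>\<^bold>] \<chi>)" by (rule MS2IC_u_conseq1) auto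
qed

section \<open>Enumeration of formulas and construction of rich theories\<close>

instance fm :: (countable) countable
  by countable_datatype

definition consistent :: "nat fm \<Rightarrow> bool" where
  "consistent \<gamma> \<longleftrightarrow> \<not> MS2IC_u (\<^bold>\<not> \<gamma>)"

text \<open>The clauses match \<open>Rule_density\<close>, \<open>Rule_join_AllBox\<close> and
  \<open>Rule_upper_AllBox\<close>. At most one of them applies to a given \<open>\<theta>\<close>,
  and a formula of any other shape is witnessed vacuously.\<close>

definition witnessed :: "nat fm \<Rightarrow> nat fm \<Rightarrow> bool" where
  "witnessed \<gamma> \<theta> \<longleftrightarrow>
     (\<forall>\<phi> \<psi>. \<theta> = \<phi> \<^bold>\<leadsto> \<psi> \<longrightarrow> (\<exists>p. MS2IC_u (\<gamma> \<^bold>\<rightarrow> (\<phi> \<^bold>\<leadsto> Var p) \<^bold>\<and> (Var p \<^bold>\<leadsto> \<psi>)))) \<and>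
     (\<forall>\<phi>. \<theta> = \<^bold>\<not> (\<^bold>[\<^bold>\<forall>\<^bold>] (\<^bold>\<not> \<phi>)) \<longrightarrow>
        (\<exists>p. MS2IC_u (\<gamma> \<^bold>\<rightarrow> (Var p \<^bold>\<leadsto> \<phi>) \<^bold>\<and> \<^bold>\<not> (\<^bold>[\<^bold>\<forall>\<^bold>] (\<^bold>\<not> Var p))))) \<and>
     (\<forall>\<phi> \<psi>. \<theta> = \<^bold>\<not> (\<^bold>[\<^bold>\<forall>\<^bold>] (\<^bold>\<box> \<phi> \<^bold>\<rightarrow> \<psi>)) \<longrightarrow>
        (\<exists>p. MS2IC_u (\<gamma> \<^bold>\<rightarrow> (Var p \<^bold>\<leadsto> \<phi>) \<^bold>\<and> \<^bold>\<not> (\<^bold>[\<^bold>\<forall>\<^bold>] (\<^bold>\<box> (Var p) \<^bold>\<rightarrow> \<psi>)))))"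

lemma fresh_variable: "\<exists>p. p \<notin> vars (\<phi> :: nat fm)"
proof -
  have "finite (vars \<phi>)" by (induction \<phi>) auto
  then show ?thesis using ex_new_if_finite infinite_UNIV_nat by blast
qed

text \<open>The second premise is a witness rule whose conclusion is the negated stage: if adding
  \<open>\<omega>\<close> refuted the stage, \<open>\<theta>\<close> alone would refute it
  too.\<close>

lemma consistent_And_witness:
  assumes "consistent (\<gamma> \<^bold>\<and> \<theta>)"
    and "MS2IC_u (\<omega> \<^bold>\<rightarrow> \<^bold>\<not> (\<gamma> \<^bold>\<and> \<theta>)) \<Longrightarrow> MS2IC_u (\<theta> \<^bold>\<rightarrow> \<^bold>\<not> (\<gamma> \<^bold>\<and> \<theta>))"
  shows "consistent ((\<gamma> \<^bold>\<and> \<theta>) \<^bold>\<and> \<omega>)"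
  unfolding consistent_def
proof
  assume "MS2IC_u (\<^bold>\<not> ((\<gamma> \<^bold>\<and> \<theta>) \<^bold>\<and> \<omega>))"
  then have "MS2IC_u (\<omega> \<^bold>\<rightarrow> \<^bold>\<not> (\<gamma> \<^bold>\<and> \<theta>))" by (rule MS2IC_u_conseq1) auto
  from assms(2)[OF this] have "MS2IC_u (\<^bold>\<not> (\<gamma> \<^bold>\<and> \<theta>))" by (rule MS2IC_u_conseq1) auto
  with assms(1) show False unfolding consistent_def by blast
qed

lemma witness_exists:
  assumes cons: "consistent (\<gamma> \<^bold>\<and> \<theta>)"
  shows "\<exists>\<omega>. consistent ((\<gamma> \<^bold>\<and> \<theta>) \<^bold>\<and> \<omega>) \<and> witnessed ((\<gamma> \<^bold>\<and> \<theta>) \<^bold>\<and> \<omega>) \<theta>"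
proof -
  \<comment> \<open>Freshness for the whole stage lets its negation serve as the side formula
    \<open>\<chi>\<close> of the rules.\<close>
  obtain p where p: "p \<notin> vars (\<gamma> \<^bold>\<and> \<theta>)" using fresh_variable by blast
  let ?g = "\<gamma> \<^bold>\<and> \<theta>"
  have elim: "MS2IC_u (?g \<^bold>\<and> \<omega> \<^bold>\<rightarrow> \<omega>)" for \<omega> by (rule MS2IC_u_conseq0) auto
  consider (density) \<phi> \<psi> where "\<theta> = \<phi> \<^bold>\<leadsto> \<psi>"
    | (join) \<phi> where "\<theta> = \<^bold>\<not> (\<^bold>[\<^bold>\<forall>\<^bold>] (\<^bold>\<not> \<phi>))"
    | (upper) \<phi> \<psi> where "\<theta> = \<^bold>\<not> (\<^bold>[\<^bold>\<forall>\<^bold>] (\<^bold>\<box> \<phi> \<^bold>\<rightarrow> \<psi>))"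
    | (other) "\<forall>\<gamma>. witnessed \<gamma> \<theta>"
    unfolding witnessed_def by blast
  then show ?thesis
  proof cases
    case density
    have "consistent (?g \<^bold>\<and> (\<phi> \<^bold>\<leadsto> Var p) \<^bold>\<and> (Var p \<^bold>\<leadsto> \<psi>))"
      using cons Rule_density[of \<phi> p \<psi> "\<^bold>\<not> ?g"] p
      by (intro consistent_And_witness) (auto simp: density)
    moreover from elim have "witnessed (?g \<^bold>\<and> (\<phi> \<^bold>\<leadsto> Var p) \<^bold>\<and> (Var p \<^bold>\<leadsto> \<psi>)) \<theta>"
      unfolding witnessed_def density by blast
    ultimately show ?thesis by blast
  next
    case join
    have "consistent (?g \<^bold>\<and> (Var p \<^bold>\<leadsto> \<phi>) \<^bold>\<and> \<^bold>\<not> (\<^bold>[\<^bold>\<forall>\<^bold>] (\<^bold>\<not> Var p)))"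
      using cons Rule_join_AllBox[of p \<phi> "\<^bold>\<not> ?g"] p
      by (intro consistent_And_witness) (auto simp: join)
    moreover from elim have "witnessed (?g \<^bold>\<and> (Var p \<^bold>\<leadsto> \<phi>) \<^bold>\<and> \<^bold>\<not> (\<^bold>[\<^bold>\<forall>\<^bold>] (\<^bold>\<not> Var p))) \<theta>"
      unfolding witnessed_def join by blast
    ultimately show ?thesis by blast
  next
    case upper
    have "consistent (?g \<^bold>\<and> (Var p \<^bold>\<leadsto> \<phi>) \<^bold>\<and> \<^bold>\<not> (\<^bold>[\<^bold>\<forall>\<^bold>] (\<^bold>\<box> (Var p) \<^bold>\<rightarrow> \<psi>)))"
      using cons Rule_upper_AllBox[of p \<phi> \<psi> "\<^bold>\<not> ?g"] p
      by (intro consistent_And_witness) (auto simp: upper)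
    moreover from elim
    have "witnessed (?g \<^bold>\<and> (Var p \<^bold>\<leadsto> \<phi>) \<^bold>\<and> \<^bold>\<not> (\<^bold>[\<^bold>\<forall>\<^bold>] (\<^bold>\<box> (Var p) \<^bold>\<rightarrow> \<psi>))) \<theta>"
      unfolding witnessed_def upper by blast
    ultimately show ?thesis by blast
  next
    case other
    \<comment> \<open>Nothing has to be witnessed here, so \<top> serves as
      \<open>\<omega>\<close>.\<close>
    have "consistent (?g \<^bold>\<and> \<^bold>\<top>)"
      using cons MS2IC_u_conseq1[of "\<^bold>\<not> (?g \<^bold>\<and> \<^bold>\<top>)" "\<^bold>\<not> ?g"] unfolding consistent_def by auto
    with other show ?thesis by blast
  qed
qed

text \<open>One step of the chain: \<open>\<theta>\<close> is added with its witness if that is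
  consistent; otherwise \<open>\<gamma>\<close> already proves the negation and is kept.\<close>

lemma witnessed_extension:
  assumes "consistent \<gamma>"
  shows "\<exists>\<gamma>'. consistent \<gamma>' \<and> MS2IC_u (\<gamma>' \<^bold>\<rightarrow> \<gamma>) \<and>
    (MS2IC_u (\<gamma>' \<^bold>\<rightarrow> \<^bold>\<not> \<theta>) \<or> MS2IC_u (\<gamma>' \<^bold>\<rightarrow> \<theta>) \<and> witnessed \<gamma>' \<theta>)"
proof (cases "consistent (\<gamma> \<^bold>\<and> \<theta>)")
  case True
  then obtain \<omega> where \<omega>: "consistent ((\<gamma> \<^bold>\<and> \<theta>) \<^bold>\<and> \<omega>)" "witnessed ((\<gamma> \<^bold>\<and> \<theta>) \<^bold>\<and> \<omega>) \<theta>"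
    using witness_exists by blast
  moreover have "MS2IC_u ((\<gamma> \<^bold>\<and> \<theta>) \<^bold>\<and> \<omega> \<^bold>\<rightarrow> \<gamma>)" "MS2IC_u ((\<gamma> \<^bold>\<and> \<theta>) \<^bold>\<and> \<omega> \<^bold>\<rightarrow> \<theta>)"
    by (rule MS2IC_u_conseq0; auto)+
  ultimately show ?thesis by blast
next
  case False
  then have "MS2IC_u (\<^bold>\<not> (\<gamma> \<^bold>\<and> \<theta>))" unfolding consistent_def by blast
  then have "MS2IC_u (\<gamma> \<^bold>\<rightarrow> \<^bold>\<not> \<theta>)" by (rule MS2IC_u_conseq1) auto
  moreover have "MS2IC_u (\<gamma> \<^bold>\<rightarrow> \<gamma>)" by (rule MS2IC_u_conseq0) auto
  ultimately show ?thesis using assms by blast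
qed

text \<open>\<open>mem_Neg\<close> combines consistency and maximality. The last three clauses
  prepare density, \<open>prec_below\<close> and upper continuity of the algebra of
  formulas.\<close>

locale rich_theory =
  fixes \<Gamma> :: "nat fm set"
  assumes MS2IC_u_mem: "MS2IC_u \<phi> \<Longrightarrow> \<phi> \<in> \<Gamma>"
    and mem_MP: "\<phi> \<^bold>\<rightarrow> \<psi> \<in> \<Gamma> \<Longrightarrow> \<phi> \<in> \<Gamma> \<Longrightarrow> \<psi> \<in> \<Gamma>"
    and mem_Neg: "\<^bold>\<not> \<phi> \<in> \<Gamma> \<longleftrightarrow> \<phi> \<notin> \<Gamma>"
    and mem_density: "\<phi> \<^bold>\<leadsto> \<psi> \<in> \<Gamma> \<Longrightarrow> \<exists>\<chi>. \<phi> \<^bold>\<leadsto> \<chi> \<in> \<Gamma> \<and> \<chi> \<^bold>\<leadsto> \<psi> \<in> \<Gamma>"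
    and mem_join: "\<^bold>[\<^bold>\<forall>\<^bold>] (\<^bold>\<not> \<phi>) \<notin> \<Gamma> \<Longrightarrow> \<exists>\<chi>. \<chi> \<^bold>\<leadsto> \<phi> \<in> \<Gamma> \<and> \<^bold>[\<^bold>\<forall>\<^bold>] (\<^bold>\<not> \<chi>) \<notin> \<Gamma>"
    and mem_upper: "\<^bold>[\<^bold>\<forall>\<^bold>] (\<^bold>\<box> \<phi> \<^bold>\<rightarrow> \<psi>) \<notin> \<Gamma> \<Longrightarrow>
      \<exists>\<chi>. \<chi> \<^bold>\<leadsto> \<phi> \<in> \<Gamma> \<and> \<^bold>[\<^bold>\<forall>\<^bold>] (\<^bold>\<box> \<chi> \<^bold>\<rightarrow> \<psi>) \<notin> \<Gamma>"

lemma rich_theory_exists: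
  assumes "consistent \<gamma>0"
  shows "\<exists>\<Gamma>. rich_theory \<Gamma> \<and> \<gamma>0 \<in> \<Gamma>"
proof -
  \<comment> \<open>Stage \<open>Suc n\<close> settles the formula with number \<open>n\<close>;
    since it implies stage \<open>n\<close>, earlier decisions persist.\<close>
  have "\<exists>g. \<forall>n. (consistent (g n) \<and> (n = 0 \<longrightarrow> g n = \<gamma>0)) \<and>
      (MS2IC_u (g (Suc n) \<^bold>\<rightarrow> g n) \<and>
       (MS2IC_u (g (Suc n) \<^bold>\<rightarrow> \<^bold>\<not> from_nat n) \<or>
        MS2IC_u (g (Suc n) \<^bold>\<rightarrow> from_nat n) \<and> witnessed (g (Suc n)) (from_nat n)))"
    by (rule dependent_nat_choice) (use assms witnessed_extension in auto)
  then obtain g where cons: "\<And>n. consistent (g n)" and g0: "g 0 = \<gamma>0"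
    and dec: "\<And>n. MS2IC_u (g (Suc n) \<^bold>\<rightarrow> g n)"
    and decide: "\<And>n. MS2IC_u (g (Suc n) \<^bold>\<rightarrow> \<^bold>\<not> from_nat n) \<or>
        MS2IC_u (g (Suc n) \<^bold>\<rightarrow> from_nat n) \<and> witnessed (g (Suc n)) (from_nat n)"
    by blast
  define \<Gamma> where "\<Gamma> = {\<theta>. \<exists>n. MS2IC_u (g n \<^bold>\<rightarrow> \<theta>)}"
  have refl: "MS2IC_u (g m \<^bold>\<rightarrow> g m)" for m by (rule MS2IC_u_conseq0) auto
  have chain: "MS2IC_u (g (m + k) \<^bold>\<rightarrow> g m)" for m k
  proof (induction k)
    case (Suc k)
    then show ?case using MS2IC_u_conseq2[OF dec[of "m + k"] Suc] by auto
  qed (simp add: refl)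
  have conseq: "\<chi> \<in> \<Gamma>" if mem: "\<phi> \<in> \<Gamma>" "\<psi> \<in> \<Gamma>" and imp: "\<And>w. prop_eval w \<phi> \<Longrightarrow> prop_eval w \<psi> \<Longrightarrow> prop_eval w \<chi>"
    for \<phi> \<psi> \<chi>
  proof -
    obtain m n where mn: "MS2IC_u (g m \<^bold>\<rightarrow> \<phi>)" "MS2IC_u (g n \<^bold>\<rightarrow> \<psi>)"
      using mem unfolding \<Gamma>_def by blast
    \<comment> \<open>Both premises are moved to the common later stage
      \<open>m + n\<close>.\<close>
    have 1: "MS2IC_u (g (m + n) \<^bold>\<rightarrow> \<phi>)"
      by (rule MS2IC_u_conseq2[OF mn(1) chain[of m n]]) auto
    have 2: "MS2IC_u (g (m + n) \<^bold>\<rightarrow> \<psi>)"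
      by (rule MS2IC_u_conseq2[OF mn(2) chain[of n m, unfolded add.commute[of n]]]) auto
    have "MS2IC_u (g (m + n) \<^bold>\<rightarrow> \<chi>)"
      by (rule MS2IC_u_conseq2[OF 1 2]) (use imp in auto)
    then show ?thesis unfolding \<Gamma>_def by blast
  qed
  have bot: "\<^bold>\<bottom> \<notin> \<Gamma>"
  proof
    assume "\<^bold>\<bottom> \<in> \<Gamma>"
    then obtain n where "MS2IC_u (g n \<^bold>\<rightarrow> \<^bold>\<bottom>)" unfolding \<Gamma>_def by blast
    then have "MS2IC_u (\<^bold>\<not> g n)" by (rule MS2IC_u_conseq1) auto
    then show False using cons unfolding consistent_def by blast
  qed
  have neg: "\<^bold>\<not> \<phi> \<in> \<Gamma> \<longleftrightarrow> \<phi> \<notin> \<Gamma>" for \<phi>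
  proof
    assume "\<^bold>\<not> \<phi> \<in> \<Gamma>"
    then show "\<phi> \<notin> \<Gamma>" using conseq[of "\<^bold>\<not> \<phi>" \<phi> "\<^bold>\<bottom>"] bot by auto
  next
    assume "\<phi> \<notin> \<Gamma>"
    then show "\<^bold>\<not> \<phi> \<in> \<Gamma>"
      using decide[of "to_nat \<phi>"] unfolding \<Gamma>_def by auto
  qed
  \<comment> \<open>The other alternative of \<open>decide\<close> would put the negation of
    \<open>\<theta>\<close> into \<open>\<Gamma>\<close> as well.\<close>
  have wit: "\<exists>n. witnessed (g n) \<theta>" if "\<theta> \<in> \<Gamma>" for \<theta>
    using decide[of "to_nat \<theta>"] that neg[of \<theta>] unfolding \<Gamma>_def by auto
  have conj: "\<phi> \<in> \<Gamma> \<and> \<psi> \<in> \<Gamma>" if "MS2IC_u (g n \<^bold>\<rightarrow> \<phi> \<^bold>\<and> \<psi>)" for n \<phi> \<psi>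
  proof -
    have "MS2IC_u (g n \<^bold>\<rightarrow> \<phi>)" "MS2IC_u (g n \<^bold>\<rightarrow> \<psi>)"
      by (rule MS2IC_u_conseq1[OF that]; auto)+
    then show ?thesis unfolding \<Gamma>_def by blast
  qed
  have "rich_theory \<Gamma>"
  proof
    fix \<phi> assume "MS2IC_u \<phi>"
    then have "MS2IC_u (g 0 \<^bold>\<rightarrow> \<phi>)" by (rule MS2IC_u_conseq1) auto
    then show "\<phi> \<in> \<Gamma>" unfolding \<Gamma>_def by blast
  next
    fix \<phi> \<psi> assume "\<phi> \<^bold>\<rightarrow> \<psi> \<in> \<Gamma>" "\<phi> \<in> \<Gamma>"
    then show "\<psi> \<in> \<Gamma>" by (rule conseq) auto
  next
    fix \<phi> show "\<^bold>\<not> \<phi> \<in> \<Gamma> \<longleftrightarrow> \<phi> \<notin> \<Gamma>" by (rule neg)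
  next
    fix \<phi> \<psi> assume "\<phi> \<^bold>\<leadsto> \<psi> \<in> \<Gamma>"
    from wit[OF this] show "\<exists>\<chi>. \<phi> \<^bold>\<leadsto> \<chi> \<in> \<Gamma> \<and> \<chi> \<^bold>\<leadsto> \<psi> \<in> \<Gamma>"
      unfolding witnessed_def using conj by blast
  next
    fix \<phi> assume "\<^bold>[\<^bold>\<forall>\<^bold>] (\<^bold>\<not> \<phi>) \<notin> \<Gamma>"
    then have "\<^bold>\<not> (\<^bold>[\<^bold>\<forall>\<^bold>] (\<^bold>\<not> \<phi>)) \<in> \<Gamma>" using neg by blast
    from wit[OF this] show "\<exists>\<chi>. \<chi> \<^bold>\<leadsto> \<phi> \<in> \<Gamma> \<and> \<^bold>[\<^bold>\<forall>\<^bold>] (\<^bold>\<not> \<chi>) \<notin> \<Gamma>"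
      unfolding witnessed_def using conj neg by blast
  next
    fix \<phi> \<psi> assume "\<^bold>[\<^bold>\<forall>\<^bold>] (\<^bold>\<box> \<phi> \<^bold>\<rightarrow> \<psi>) \<notin> \<Gamma>"
    then have "\<^bold>\<not> (\<^bold>[\<^bold>\<forall>\<^bold>] (\<^bold>\<box> \<phi> \<^bold>\<rightarrow> \<psi>)) \<in> \<Gamma>" using neg by blast
    from wit[OF this] show "\<exists>\<chi>. \<chi> \<^bold>\<leadsto> \<phi> \<in> \<Gamma> \<and> \<^bold>[\<^bold>\<forall>\<^bold>] (\<^bold>\<box> \<chi> \<^bold>\<rightarrow> \<psi>) \<notin> \<Gamma>"
      unfolding witnessed_def using conj neg by blast
  qed
  moreover have "\<gamma>0 \<in> \<Gamma>" using refl[of 0] g0 unfolding \<Gamma>_def by auto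
  ultimately show ?thesis by blast
qed

section \<open>The Lindenbaum algebra of a rich theory\<close>

context rich_theory
begin

lemma mem_conseq1:
  assumes "\<phi> \<in> \<Gamma>" "\<And>w. prop_eval w \<phi> \<Longrightarrow> prop_eval w \<chi>"
  shows "\<chi> \<in> \<Gamma>"
  by (rule mem_MP[OF MS2IC_u_mem[OF MS2IC_u_conseq0] assms(1)]) (simp add: assms(2))

lemma mem_conseq2:
  assumes "\<phi> \<in> \<Gamma>" "\<psi> \<in> \<Gamma>" "\<And>w. prop_eval w \<phi> \<Longrightarrow> prop_eval w \<psi> \<Longrightarrow> prop_eval w \<chi>"
  shows "\<chi> \<in> \<Gamma>"
  by (rule mem_MP[OF mem_conseq1[OF assms(1)] assms(2)]) (simp add: assms(3))

lemma mem_iff: "\<phi> \<^bold>\<leftrightarrow> \<psi> \<in> \<Gamma> \<Longrightarrow> \<phi> \<in> \<Gamma> \<longleftrightarrow> \<psi> \<in> \<Gamma>"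
  using mem_conseq2[of "\<phi> \<^bold>\<leftrightarrow> \<psi>" \<phi> \<psi>] mem_conseq2[of "\<phi> \<^bold>\<leftrightarrow> \<psi>" \<psi> \<phi>] by auto

lemma mem_And: "\<phi> \<^bold>\<and> \<psi> \<in> \<Gamma> \<longleftrightarrow> \<phi> \<in> \<Gamma> \<and> \<psi> \<in> \<Gamma>"
  using mem_conseq1[of "\<phi> \<^bold>\<and> \<psi>" \<phi>] mem_conseq1[of "\<phi> \<^bold>\<and> \<psi>" \<psi>] mem_conseq2[of \<phi> \<psi> "\<phi> \<^bold>\<and> \<psi>"]
  by auto

text \<open>These become the formulas of class \<one>, whereas membership in \<open>\<Gamma>\<close>
  is truth at a single point. Closure under \<box> (\<open>glob_Box\<close>) makes equivalence
  modulo \<open>glob\<close> respect the modality.\<close>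

definition glob :: "nat fm set" where
  "glob = {\<phi>. \<^bold>[\<^bold>\<forall>\<^bold>] \<phi> \<in> \<Gamma>}"

lemma glob_MS2IC_u: "MS2IC_u \<phi> \<Longrightarrow> \<phi> \<in> glob"
  unfolding glob_def using MS2IC_u_mem Nec_All by blast

lemma glob_MP: "\<phi> \<^bold>\<rightarrow> \<psi> \<in> glob \<Longrightarrow> \<phi> \<in> glob \<Longrightarrow> \<psi> \<in> glob"
  unfolding glob_def using mem_MP MS2IC_u_mem[OF AllBox_K] by blast

lemma glob_conseq0:
  assumes "\<And>w. prop_eval w \<chi>"
  shows "\<chi> \<in> glob"
  using glob_MS2IC_u MS2IC_u_conseq0 assms by blast

lemma glob_conseq1:
  assumes "\<phi> \<in> glob" "\<And>w. prop_eval w \<phi> \<Longrightarrow> prop_eval w \<chi>"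
  shows "\<chi> \<in> glob"
  by (rule glob_MP[OF glob_conseq0 assms(1)]) (simp add: assms(2))

lemma glob_conseq2:
  assumes "\<phi> \<in> glob" "\<psi> \<in> glob" "\<And>w. prop_eval w \<phi> \<Longrightarrow> prop_eval w \<psi> \<Longrightarrow> prop_eval w \<chi>"
  shows "\<chi> \<in> glob"
  by (rule glob_MP[OF glob_conseq1[OF assms(1)] assms(2)]) (simp add: assms(3))

lemma glob_mem: "\<phi> \<in> glob \<Longrightarrow> \<phi> \<in> \<Gamma>"
  unfolding glob_def using mem_MP MS2IC_u_mem[OF AllBox_T] by blast

lemma glob_Box: "\<phi> \<in> glob \<Longrightarrow> \<^bold>\<box> \<phi> \<in> glob"
  unfolding glob_def using mem_MP MS2IC_u_mem[OF AllBox_Box] by blast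

lemma glob_Box_mono: "\<phi> \<^bold>\<rightarrow> \<psi> \<in> glob \<Longrightarrow> \<^bold>\<box> \<phi> \<^bold>\<rightarrow> \<^bold>\<box> \<psi> \<in> glob"
  using glob_Box glob_MP glob_MS2IC_u[OF K] by blast

lemma SImp_glob: "\<phi> \<^bold>\<leadsto> \<psi> \<in> \<Gamma> \<Longrightarrow> \<phi> \<^bold>\<leadsto> \<psi> \<in> glob"
  unfolding glob_def using mem_iff[OF MS2IC_u_mem[OF A10]] by blast

text \<open>By \<open>A9\<close> the failure of an \<open>AllBox\<close> formula is itself global,
  and \<open>A10\<close> removes the inner \<open>AllBox\<close>. With \<open>SImp_glob\<close>,
  every strict implication is globally true or globally false, as evaluation requires.\<close>

lemma not_SImp_glob:
  assumes "\<phi> \<^bold>\<leadsto> \<psi> \<notin> \<Gamma>"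
  shows "\<^bold>\<not> (\<phi> \<^bold>\<leadsto> \<psi>) \<in> glob"
proof -
  have "\<^bold>\<not> (\<^bold>[\<^bold>\<forall>\<^bold>] (\<phi> \<^bold>\<leadsto> \<psi>)) \<in> \<Gamma>"
    using assms mem_iff[OF MS2IC_u_mem[OF A10]] mem_Neg by blast
  then have "\<^bold>\<not> (\<^bold>[\<^bold>\<forall>\<^bold>] (\<phi> \<^bold>\<leadsto> \<psi>)) \<in> glob"
    unfolding glob_def using mem_MP MS2IC_u_mem[OF A9] by blast
  then show ?thesis
    by (rule glob_conseq2[OF glob_MS2IC_u[OF A10[of \<phi> \<psi>]]]) auto
qed

text \<open>The implications here need only be global in \<open>\<Gamma>\<close>, not provable, so
  \<open>AllBox_SImp_left\<close> and \<open>AllBox_SImp_right\<close> take the place of the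
  monotonicity rules.\<close>

lemma SImp_mem_mono:
  assumes "\<phi>' \<^bold>\<rightarrow> \<phi> \<in> glob" "\<phi> \<^bold>\<leadsto> \<psi> \<in> \<Gamma>" "\<psi> \<^bold>\<rightarrow> \<psi>' \<in> glob"
  shows "\<phi>' \<^bold>\<leadsto> \<psi>' \<in> \<Gamma>"
proof -
  have "\<^bold>[\<^bold>\<forall>\<^bold>] (\<phi>' \<^bold>\<rightarrow> \<phi>) \<in> \<Gamma>" "\<^bold>[\<^bold>\<forall>\<^bold>] (\<psi> \<^bold>\<rightarrow> \<psi>') \<in> \<Gamma>"
    using assms unfolding glob_def by auto
  note imp = this[THEN mem_MP[OF MS2IC_u_mem, rotated]]
  from imp(1)[OF AllBox_SImp_left] have "\<phi>' \<^bold>\<leadsto> \<psi> \<in> \<Gamma>" using assms(2) by (rule mem_MP)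
  with imp(2)[OF AllBox_SImp_right] show ?thesis by (rule mem_MP)
qed

lemma SImp_mem_imp_glob: "\<phi> \<^bold>\<leadsto> \<psi> \<in> \<Gamma> \<Longrightarrow> \<phi> \<^bold>\<rightarrow> \<psi> \<in> glob"
  using SImp_glob glob_MP glob_MS2IC_u[OF A4] by blast

end

section \<open>Formulas modulo \<open>glob\<close>, coded into an arbitrary type\<close>

locale lindenbaum = rich_theory +
  fixes code :: "nat fm \<Rightarrow> 'a"
  assumes inj_code: "inj code"
begin

text \<open>Coding a chosen representative instead of the class itself means that an injection of
  formulas, not of sets of formulas, suffices to place the quotient in \<open>'a\<close>.\<close>

definition cls :: "nat fm \<Rightarrow> 'a" where
  "cls \<phi> = code (SOME \<psi>. \<phi> \<^bold>\<leftrightarrow> \<psi> \<in> glob)"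

definition rep :: "'a \<Rightarrow> nat fm" where
  "rep a = (SOME \<psi>. cls \<psi> = a)"

text \<open>Equivalent formulas have the same candidates and hence the same choice; conversely, each
  formula is equivalent to the one chosen for it.\<close>

lemma cls_eq_iff: "cls \<phi> = cls \<psi> \<longleftrightarrow> \<phi> \<^bold>\<leftrightarrow> \<psi> \<in> glob"
proof
  have some: "\<phi> \<^bold>\<leftrightarrow> (SOME \<chi>. \<phi> \<^bold>\<leftrightarrow> \<chi> \<in> glob) \<in> glob" for \<phi>
    by (rule someI[of _ \<phi>]) (auto intro: glob_conseq0)
  assume "cls \<phi> = cls \<psi>"
  then have eq: "(SOME \<chi>. \<phi> \<^bold>\<leftrightarrow> \<chi> \<in> glob) = (SOME \<chi>. \<psi> \<^bold>\<leftrightarrow> \<chi> \<in> glob)"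
    using inj_code unfolding cls_def by (simp add: inj_eq)
  show "\<phi> \<^bold>\<leftrightarrow> \<psi> \<in> glob"
    by (rule glob_conseq2[OF some[of \<phi>, unfolded eq] some[of \<psi>]]) auto
next
  assume 1: "\<phi> \<^bold>\<leftrightarrow> \<psi> \<in> glob"
  have "\<phi> \<^bold>\<leftrightarrow> \<chi> \<in> glob \<longleftrightarrow> \<psi> \<^bold>\<leftrightarrow> \<chi> \<in> glob" for \<chi>
  proof
    show "\<phi> \<^bold>\<leftrightarrow> \<chi> \<in> glob \<Longrightarrow> \<psi> \<^bold>\<leftrightarrow> \<chi> \<in> glob" by (rule glob_conseq2[OF 1]) auto
    show "\<psi> \<^bold>\<leftrightarrow> \<chi> \<in> glob \<Longrightarrow> \<phi> \<^bold>\<leftrightarrow> \<chi> \<in> glob" by (rule glob_conseq2[OF 1]) auto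
  qed
  then show "cls \<phi> = cls \<psi>" unfolding cls_def by simp
qed

lemma cls_eqI: "(\<And>w. prop_eval w \<phi> \<longleftrightarrow> prop_eval w \<psi>) \<Longrightarrow> cls \<phi> = cls \<psi>"
  by (auto simp: cls_eq_iff intro: glob_conseq0)

lemma rep_cls: "\<phi> \<^bold>\<leftrightarrow> rep (cls \<phi>) \<in> glob"
proof -
  have "cls (rep (cls \<phi>)) = cls \<phi>" unfolding rep_def by (rule someI) simp
  then show ?thesis by (metis cls_eq_iff)
qed

text \<open>Operations act on representatives; the lemmas from \<open>alg_meet\<close> to
  \<open>alg_le\<close> show that the choice does not matter.\<close>

definition alg :: "'a modal_alg" where
  "alg = \<lparr>carrier = range cls,
     meet = (\<lambda>a b. cls (rep a \<^bold>\<and> rep b)),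
     join = (\<lambda>a b. cls (rep a \<^bold>\<or> rep b)),
     cmpl = (\<lambda>a. cls (\<^bold>\<not> rep a)),
     bzero = cls \<^bold>\<bottom>, bone = cls \<^bold>\<top>,
     prec = (\<lambda>a b. rep a \<^bold>\<leadsto> rep b \<in> \<Gamma>),
     dia = (\<lambda>a. cls (\<^bold>\<not> \<^bold>\<box> (\<^bold>\<not> rep a)))\<rparr>"

lemma alg_constants: "\<zero>\<^bsub>alg\<^esub> = cls \<^bold>\<bottom>" "\<one>\<^bsub>alg\<^esub> = cls \<^bold>\<top>" "carrier alg = range cls"
  by (simp_all add: alg_def)

lemma alg_meet: "cls \<phi> \<sqinter>\<^bsub>alg\<^esub> cls \<psi> = cls (\<phi> \<^bold>\<and> \<psi>)"
  unfolding alg_def by (simp add: cls_eq_iff) (rule glob_conseq2[OF rep_cls[of \<phi>] rep_cls[of \<psi>]], auto)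

lemma alg_join: "cls \<phi> \<squnion>\<^bsub>alg\<^esub> cls \<psi> = cls (\<phi> \<^bold>\<or> \<psi>)"
  unfolding alg_def by (simp add: cls_eq_iff) (rule glob_conseq2[OF rep_cls[of \<phi>] rep_cls[of \<psi>]], auto)

lemma alg_cmpl: "\<sim>\<^bsub>alg\<^esub> cls \<phi> = cls (\<^bold>\<not> \<phi>)"
  unfolding alg_def by (simp add: cls_eq_iff) (rule glob_conseq1[OF rep_cls[of \<phi>]], auto)

lemma alg_prec: "cls \<phi> \<prec>\<^bsub>alg\<^esub> cls \<psi> \<longleftrightarrow> \<phi> \<^bold>\<leadsto> \<psi> \<in> \<Gamma>"
proof -
  have r: "\<phi> \<^bold>\<rightarrow> rep (cls \<phi>) \<in> glob" "rep (cls \<phi>) \<^bold>\<rightarrow> \<phi> \<in> glob" for \<phi>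
    by (rule glob_conseq1[OF rep_cls[of \<phi>]]; auto)+
  have "rep (cls \<phi>) \<^bold>\<leadsto> rep (cls \<psi>) \<in> \<Gamma> \<longleftrightarrow> \<phi> \<^bold>\<leadsto> \<psi> \<in> \<Gamma>"
    by (rule iffI) (erule SImp_mem_mono[OF r(1) _ r(2)] SImp_mem_mono[OF r(2) _ r(1)])+
  then show ?thesis by (simp add: alg_def)
qed

lemma alg_dia: "\<diamond>\<^bsub>alg\<^esub> cls \<phi> = cls (\<^bold>\<not> \<^bold>\<box> (\<^bold>\<not> \<phi>))"
proof -
  let ?r = "rep (cls \<phi>)"
  have "\<^bold>\<not> \<phi> \<^bold>\<rightarrow> \<^bold>\<not> ?r \<in> glob" "\<^bold>\<not> ?r \<^bold>\<rightarrow> \<^bold>\<not> \<phi> \<in> glob"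
    by (rule glob_conseq1[OF rep_cls[of \<phi>]]; auto)+
  then have "\<^bold>\<box> (\<^bold>\<not> \<phi>) \<^bold>\<rightarrow> \<^bold>\<box> (\<^bold>\<not> ?r) \<in> glob" "\<^bold>\<box> (\<^bold>\<not> ?r) \<^bold>\<rightarrow> \<^bold>\<box> (\<^bold>\<not> \<phi>) \<in> glob"
    using glob_Box_mono by blast+
  then have "\<^bold>\<not> \<^bold>\<box> (\<^bold>\<not> ?r) \<^bold>\<leftrightarrow> \<^bold>\<not> \<^bold>\<box> (\<^bold>\<not> \<phi>) \<in> glob" by (rule glob_conseq2) auto
  then show ?thesis unfolding alg_def by (simp add: cls_eq_iff)
qed

lemma alg_le: "cls \<phi> \<sqsubseteq>\<^bsub>alg\<^esub> cls \<psi> \<longleftrightarrow> \<phi> \<^bold>\<rightarrow> \<psi> \<in> glob"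
  unfolding ble_def alg_meet cls_eq_iff
  by (auto elim: glob_conseq1)

lemmas alg_simps = alg_constants alg_meet alg_join alg_cmpl alg_prec alg_dia alg_le

lemma alg_boolean: "boolean_alg alg"
  by unfold_locales (auto simp: alg_simps intro!: cls_eqI)

lemma alg_contact: "contact_algebra alg"
proof -
  interpret boolean_alg alg by (rule alg_boolean)
  have A1': "\<^bold>\<bottom> \<^bold>\<leadsto> \<phi> \<in> \<Gamma>" "\<phi> \<^bold>\<leadsto> \<^bold>\<top> \<in> \<Gamma>" for \<phi>
    using MS2IC_u_mem[OF A1] mem_And by blast+
  show ?thesis
  proof unfold_locales
    fix a b c assume "a \<in> carrier alg" "b \<in> carrier alg" "c \<in> carrier alg" "a \<prec>\<^bsub>alg\<^esub> b" "a \<prec>\<^bsub>alg\<^esub> c"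
    then show "a \<prec>\<^bsub>alg\<^esub> b \<sqinter>\<^bsub>alg\<^esub> c"
      using mem_iff[OF MS2IC_u_mem[OF A3]] by (auto simp: alg_simps mem_And)
  next
    fix a b c assume "a \<in> carrier alg" "b \<in> carrier alg" "c \<in> carrier alg" "a \<prec>\<^bsub>alg\<^esub> c" "b \<prec>\<^bsub>alg\<^esub> c"
    then show "a \<squnion>\<^bsub>alg\<^esub> b \<prec>\<^bsub>alg\<^esub> c"
      using mem_iff[OF MS2IC_u_mem[OF A2]] by (auto simp: alg_simps mem_And)
  next
    fix a b c d
    assume "a \<in> carrier alg" "b \<in> carrier alg" "c \<in> carrier alg" "d \<in> carrier alg"
      "a \<sqsubseteq>\<^bsub>alg\<^esub> b" "b \<prec>\<^bsub>alg\<^esub> c" "c \<sqsubseteq>\<^bsub>alg\<^esub> d"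
    then show "a \<prec>\<^bsub>alg\<^esub> d" using SImp_mem_mono by (auto simp: alg_simps)
  next
    fix a b assume "a \<in> carrier alg" "b \<in> carrier alg" "a \<prec>\<^bsub>alg\<^esub> b"
    then show "a \<sqsubseteq>\<^bsub>alg\<^esub> b" using SImp_mem_imp_glob by (auto simp: alg_simps)
  next
    fix a b assume "a \<in> carrier alg" "b \<in> carrier alg" "a \<prec>\<^bsub>alg\<^esub> b"
    then show "\<sim>\<^bsub>alg\<^esub> b \<prec>\<^bsub>alg\<^esub> \<sim>\<^bsub>alg\<^esub> a"
      using mem_iff[OF MS2IC_u_mem[OF A5]] by (auto simp: alg_simps)
  qed (simp_all add: alg_simps A1')
qed

lemma alg_compingent: "compingent_algebra alg"
proof -
  interpret contact_algebra alg by (rule alg_contact)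
  \<comment> \<open>Brings nonzero classes into the form used by \<open>mem_join\<close>.\<close>
  have eq_zero: "cls \<phi> = cls \<^bold>\<bottom> \<longleftrightarrow> \<^bold>[\<^bold>\<forall>\<^bold>] (\<^bold>\<not> \<phi>) \<in> \<Gamma>" for \<phi>
  proof -
    have "\<phi> \<^bold>\<leftrightarrow> \<^bold>\<bottom> \<in> glob \<longleftrightarrow> \<^bold>\<not> \<phi> \<in> glob" by (auto elim: glob_conseq1)
    then show ?thesis unfolding cls_eq_iff glob_def by simp
  qed
  show ?thesis
  proof unfold_locales
    fix a b assume "a \<in> carrier alg" "b \<in> carrier alg" "a \<prec>\<^bsub>alg\<^esub> b"
    then show "\<exists>c\<in>carrier alg. a \<prec>\<^bsub>alg\<^esub> c \<and> c \<prec>\<^bsub>alg\<^esub> b"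
      using mem_density by (auto simp: alg_simps)
  next
    fix a assume "a \<in> carrier alg" "a \<noteq> \<zero>\<^bsub>alg\<^esub>"
    then show "\<exists>b\<in>carrier alg. b \<noteq> \<zero>\<^bsub>alg\<^esub> \<and> b \<prec>\<^bsub>alg\<^esub> a"
      using mem_join by (fastforce simp: alg_simps eq_zero)
  qed
qed

lemma Box_Neg_conj: "\<^bold>\<box> (\<^bold>\<not> \<phi>) \<^bold>\<and> \<^bold>\<box> (\<^bold>\<not> \<psi>) \<^bold>\<rightarrow> \<^bold>\<box> (\<^bold>\<not> (\<phi> \<^bold>\<or> \<psi>)) \<in> glob"
proof -
  have "\<^bold>\<not> \<phi> \<^bold>\<and> \<^bold>\<not> \<psi> \<^bold>\<rightarrow> \<^bold>\<not> (\<phi> \<^bold>\<or> \<psi>) \<in> glob" by (rule glob_conseq0) auto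
  then show ?thesis
    by (rule glob_conseq2[OF glob_Box_mono glob_MS2IC_u[OF Box_And[of "\<^bold>\<not> \<phi>" "\<^bold>\<not> \<psi>"]]]) auto
qed

text \<open>\<open>Add\<close> between two contrapositions by \<open>A5\<close>.\<close>

lemma SImp_dia:
  assumes "\<phi> \<^bold>\<leadsto> \<psi> \<in> \<Gamma>"
  shows "\<^bold>\<not> \<^bold>\<box> (\<^bold>\<not> \<phi>) \<^bold>\<leadsto> \<^bold>\<not> \<^bold>\<box> (\<^bold>\<not> \<psi>) \<in> \<Gamma>"
  using assms mem_iff[OF MS2IC_u_mem[OF A5]] mem_MP[OF MS2IC_u_mem[OF Add]] by blast

text \<open>If a lower bound \<open>cls \<xi>\<close> were not below
  \<open>\<diamond> cls \<phi>\<close>, \<open>mem_upper\<close> would give \<open>\<chi>\<close>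
  strictly implying \<open>\<not> \<phi>\<close> such that
  \<open>\<box> \<chi> \<rightarrow> \<not> \<xi>\<close> is not global. But
  \<open>\<phi> \<leadsto> \<not> \<chi>\<close> then holds, and being a lower bound at
  \<open>\<not> \<chi>\<close> makes that very formula global.\<close>

lemma alg_upper: "is_meet_of alg (\<diamond>\<^bsub>alg\<^esub> cls \<phi>) {\<diamond>\<^bsub>alg\<^esub> b | b. b \<in> carrier alg \<and> cls \<phi> \<prec>\<^bsub>alg\<^esub> b}"
  unfolding is_meet_of_def
proof (intro conjI ballI impI)
  show "\<diamond>\<^bsub>alg\<^esub> cls \<phi> \<in> carrier alg" by (simp add: alg_simps)
next
  fix s assume "s \<in> {\<diamond>\<^bsub>alg\<^esub> b | b. b \<in> carrier alg \<and> cls \<phi> \<prec>\<^bsub>alg\<^esub> b}"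
  then obtain \<psi> where "s = \<diamond>\<^bsub>alg\<^esub> cls \<psi>" "\<phi> \<^bold>\<leadsto> \<psi> \<in> \<Gamma>" by (auto simp: alg_simps)
  then show "\<diamond>\<^bsub>alg\<^esub> cls \<phi> \<sqsubseteq>\<^bsub>alg\<^esub> s" by (simp add: alg_simps SImp_dia SImp_mem_imp_glob)
next
  fix l assume "l \<in> carrier alg"
    and low: "\<forall>s\<in>{\<diamond>\<^bsub>alg\<^esub> b | b. b \<in> carrier alg \<and> cls \<phi> \<prec>\<^bsub>alg\<^esub> b}. l \<sqsubseteq>\<^bsub>alg\<^esub> s"
  then obtain \<xi> where l: "l = cls \<xi>" by (auto simp: alg_simps)
  have low': "\<xi> \<^bold>\<rightarrow> \<^bold>\<not> \<^bold>\<box> (\<^bold>\<not> \<psi>) \<in> glob" if "\<phi> \<^bold>\<leadsto> \<psi> \<in> \<Gamma>" for \<psi>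
  proof -
    have "l \<sqsubseteq>\<^bsub>alg\<^esub> \<diamond>\<^bsub>alg\<^esub> cls \<psi>" using low that alg_prec[of \<phi> \<psi>] alg_constants(3) by blast
    then show ?thesis by (simp add: l alg_simps)
  qed
  have "\<^bold>\<box> (\<^bold>\<not> \<phi>) \<^bold>\<rightarrow> \<^bold>\<not> \<xi> \<in> glob"
  proof (rule ccontr)
    assume "\<^bold>\<box> (\<^bold>\<not> \<phi>) \<^bold>\<rightarrow> \<^bold>\<not> \<xi> \<notin> glob"
    then obtain \<chi> where \<chi>: "\<chi> \<^bold>\<leadsto> \<^bold>\<not> \<phi> \<in> \<Gamma>" "\<^bold>\<box> \<chi> \<^bold>\<rightarrow> \<^bold>\<not> \<xi> \<notin> glob"
      using mem_upper unfolding glob_def by blast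
    have "\<phi> \<^bold>\<leadsto> \<^bold>\<not> \<chi> \<in> \<Gamma>"
    proof (rule SImp_mem_mono)
      show "\<^bold>\<not> \<^bold>\<not> \<phi> \<^bold>\<leadsto> \<^bold>\<not> \<chi> \<in> \<Gamma>" using \<chi>(1) mem_iff[OF MS2IC_u_mem[OF A5]] by blast
    qed (rule glob_conseq0; auto)+
    then have 1: "\<xi> \<^bold>\<rightarrow> \<^bold>\<not> \<^bold>\<box> (\<^bold>\<not> \<^bold>\<not> \<chi>) \<in> glob" by (rule low')
    have "\<chi> \<^bold>\<rightarrow> \<^bold>\<not> \<^bold>\<not> \<chi> \<in> glob" by (rule glob_conseq0) auto
    then have "\<^bold>\<box> \<chi> \<^bold>\<rightarrow> \<^bold>\<box> (\<^bold>\<not> \<^bold>\<not> \<chi>) \<in> glob" by (rule glob_Box_mono)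
    with 1 have "\<^bold>\<box> \<chi> \<^bold>\<rightarrow> \<^bold>\<not> \<xi> \<in> glob" by (rule glob_conseq2) auto
    with \<chi>(2) show False by blast
  qed
  then have "\<xi> \<^bold>\<rightarrow> \<^bold>\<not> \<^bold>\<box> (\<^bold>\<not> \<phi>) \<in> glob" by (rule glob_conseq1) auto
  then show "l \<sqsubseteq>\<^bsub>alg\<^esub> \<diamond>\<^bsub>alg\<^esub> cls \<phi>" by (simp add: l alg_simps)
qed

lemma alg_modal: "upper_continuous_modal_compingent_algebra alg"
proof -
  interpret compingent_algebra alg by (rule alg_compingent)
  show ?thesis
  proof unfold_locales
    fix a assume "a \<in> carrier alg"
    then show "\<diamond>\<^bsub>alg\<^esub> a \<in> carrier alg" by (auto simp: alg_simps)
  next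
    have "\<^bold>\<not> \<^bold>\<bottom> \<in> glob" by (rule glob_conseq0) auto
    then have "\<^bold>\<box> (\<^bold>\<not> \<^bold>\<bottom>) \<in> glob" by (rule glob_Box)
    then have "\<^bold>\<not> \<^bold>\<box> (\<^bold>\<not> \<^bold>\<bottom>) \<^bold>\<leftrightarrow> \<^bold>\<bottom> \<in> glob" by (rule glob_conseq1) auto
    then show "\<diamond>\<^bsub>alg\<^esub> \<zero>\<^bsub>alg\<^esub> = \<zero>\<^bsub>alg\<^esub>" by (simp add: alg_simps cls_eq_iff)
  next
    fix a1 b1 a2 b2
    assume A: "a1 \<in> carrier alg" "b1 \<in> carrier alg" "a2 \<in> carrier alg" "b2 \<in> carrier alg"
      "a1 \<prec>\<^bsub>alg\<^esub> b1" "a2 \<prec>\<^bsub>alg\<^esub> b2"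
    then obtain \<phi>1 \<psi>1 \<phi>2 \<psi>2 where f: "a1 = cls \<phi>1" "b1 = cls \<psi>1" "a2 = cls \<phi>2" "b2 = cls \<psi>2"
      by (auto simp: alg_constants)
    have m: "\<phi>1 \<^bold>\<leadsto> \<psi>1 \<in> \<Gamma>" "\<phi>2 \<^bold>\<leadsto> \<psi>2 \<in> \<Gamma>" using A by (simp_all add: f alg_simps)
    \<comment> \<open>Both premises are weakened to a common consequent, so that \<open>A2\<close>
      and \<open>SImp_dia\<close> apply once to the disjunctions; \<open>Box_Neg_conj\<close> then
      splits the diamond on the right.\<close>
    have "\<phi>1 \<^bold>\<leadsto> (\<psi>1 \<^bold>\<or> \<psi>2) \<in> \<Gamma>" "\<phi>2 \<^bold>\<leadsto> (\<psi>1 \<^bold>\<or> \<psi>2) \<in> \<Gamma>"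
      by (rule SImp_mem_mono[OF _ m(1)] SImp_mem_mono[OF _ m(2)]; rule glob_conseq0; auto)+
    then have "(\<phi>1 \<^bold>\<or> \<phi>2) \<^bold>\<leadsto> (\<psi>1 \<^bold>\<or> \<psi>2) \<in> \<Gamma>"
      using mem_iff[OF MS2IC_u_mem[OF A2]] mem_And by blast
    then have "\<^bold>\<not> \<^bold>\<box> (\<^bold>\<not> (\<phi>1 \<^bold>\<or> \<phi>2)) \<^bold>\<leadsto> \<^bold>\<not> \<^bold>\<box> (\<^bold>\<not> (\<psi>1 \<^bold>\<or> \<psi>2)) \<in> \<Gamma>" by (rule SImp_dia)
    then have "\<^bold>\<not> \<^bold>\<box> (\<^bold>\<not> (\<phi>1 \<^bold>\<or> \<phi>2)) \<^bold>\<leadsto> (\<^bold>\<not> \<^bold>\<box> (\<^bold>\<not> \<psi>1) \<^bold>\<or> \<^bold>\<not> \<^bold>\<box> (\<^bold>\<not> \<psi>2)) \<in> \<Gamma>"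
    proof (rule SImp_mem_mono[rotated])
      show "\<^bold>\<not> \<^bold>\<box> (\<^bold>\<not> (\<psi>1 \<^bold>\<or> \<psi>2)) \<^bold>\<rightarrow> \<^bold>\<not> \<^bold>\<box> (\<^bold>\<not> \<psi>1) \<^bold>\<or> \<^bold>\<not> \<^bold>\<box> (\<^bold>\<not> \<psi>2) \<in> glob"
        by (rule glob_conseq1[OF Box_Neg_conj[of \<psi>1 \<psi>2]]) auto
    qed (rule glob_conseq0; auto)
    then show "\<diamond>\<^bsub>alg\<^esub> (a1 \<squnion>\<^bsub>alg\<^esub> a2) \<prec>\<^bsub>alg\<^esub> \<diamond>\<^bsub>alg\<^esub> b1 \<squnion>\<^bsub>alg\<^esub> \<diamond>\<^bsub>alg\<^esub> b2"
      by (simp add: f alg_simps)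
  next
    fix a assume "a \<in> carrier alg"
    then obtain \<phi> where "a = cls \<phi>" by (auto simp: alg_constants)
    then show "is_meet_of alg (\<diamond>\<^bsub>alg\<^esub> a) {\<diamond>\<^bsub>alg\<^esub> b | b. b \<in> carrier alg \<and> a \<prec>\<^bsub>alg\<^esub> b}"
      using alg_upper by simp
  qed
qed

text \<open>The truth lemma for the canonical valuation. Strict implications have class \<one> or
  \<zero> by the global dichotomy, and for \<box> the double negations introduced by evaluation are
  removed inside and outside the box.\<close>

lemma eval_alg: "eval alg (\<lambda>p. cls (Var p)) \<phi> = cls \<phi>"
proof (induction \<phi>)
  case (SImp \<phi> \<psi>)
  have "cls (\<phi> \<^bold>\<leadsto> \<psi>) = cls \<^bold>\<top>" if "\<phi> \<^bold>\<leadsto> \<psi> \<in> \<Gamma>"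
    unfolding cls_eq_iff by (rule glob_conseq1[OF SImp_glob[OF that]]) auto
  moreover have "cls (\<phi> \<^bold>\<leadsto> \<psi>) = cls \<^bold>\<bottom>" if "\<phi> \<^bold>\<leadsto> \<psi> \<notin> \<Gamma>"
    unfolding cls_eq_iff by (rule glob_conseq1[OF not_SImp_glob[OF that]]) auto
  ultimately show ?case using SImp by (simp add: alg_simps)
next
  case (Box \<phi>)
  have "\<phi> \<^bold>\<rightarrow> \<^bold>\<not> \<^bold>\<not> \<phi> \<in> glob" "\<^bold>\<not> \<^bold>\<not> \<phi> \<^bold>\<rightarrow> \<phi> \<in> glob" by (rule glob_conseq0; auto)+
  from this[THEN glob_Box_mono]
  have "\<^bold>\<not> \<^bold>\<not> \<^bold>\<box> (\<^bold>\<not> \<^bold>\<not> \<phi>) \<^bold>\<leftrightarrow> \<^bold>\<box> \<phi> \<in> glob" by (rule glob_conseq2) auto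
  then show ?case using Box by (simp add: alg_simps cls_eq_iff)
qed (auto simp: alg_simps intro!: cls_eqI)

lemma valid_in_alg_mem:
  assumes "valid_in alg \<phi>"
  shows "\<phi> \<in> \<Gamma>"
proof -
  have "eval alg (\<lambda>p. cls (Var p)) \<phi> = cls \<^bold>\<top>"
    using assms unfolding valid_in_def alg_constants by (elim allE impE) auto
  then have "\<phi> \<^bold>\<leftrightarrow> \<^bold>\<top> \<in> glob" by (simp add: eval_alg cls_eq_iff)
  then have "\<phi> \<in> glob" by (rule glob_conseq1) auto
  then show ?thesis by (rule glob_mem)
qed

end

section \<open>Completeness and the equivalence\<close>

lemma completeness:
  assumes inf: "infinite (UNIV :: 'a set)"
    and valid: "\<And>A :: 'a modal_alg. upper_continuous_modal_compingent_algebra A \<Longrightarrow> valid_in A \<phi>"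
  shows "MS2IC_u \<phi>"
proof (rule ccontr)
  assume "\<not> MS2IC_u \<phi>"
  then have "consistent (\<^bold>\<not> \<phi>)"
    using MS2IC_u_conseq1[of "\<^bold>\<not> \<^bold>\<not> \<phi>" \<phi>] unfolding consistent_def by auto
  then obtain \<Gamma> where \<Gamma>: "rich_theory \<Gamma>" "\<^bold>\<not> \<phi> \<in> \<Gamma>" using rich_theory_exists by blast
  obtain f :: "nat \<Rightarrow> 'a" where f: "inj f" using inf infinite_countable_subset by blast
  \<comment> \<open>Formulas are numbered by \<open>to_nat\<close> and embedded by \<open>f\<close>,
    so the algebra lives on \<open>'a\<close>, where \<open>valid\<close> applies.\<close>
  interpret lindenbaum \<Gamma> "f \<circ> to_nat"
    using \<Gamma>(1) f by (intro lindenbaum.intro lindenbaum_axioms.intro inj_compose) auto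
  have "\<phi> \<in> \<Gamma>" using valid_in_alg_mem valid alg_modal by blast
  with \<Gamma>(2) mem_Neg show False by blast
qed

theorem theorem3p10:
  fixes \<phi> :: "nat fm"
  assumes "infinite (UNIV :: 'a set)"
  shows "MS2IC_u \<phi> \<longleftrightarrow>
    (\<forall>A :: 'a modal_alg. upper_continuous_modal_compingent_algebra A \<longrightarrow> valid_in A \<phi>)"
  using completeness[OF assms] upper_continuous_modal_compingent_algebra.soundness
  unfolding valid_in_def by blast

end
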